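(* Let $A=I-N\in\mathbb R^{n\times n}$, $n\ge 2$, $N\ge 0$, be a singular M-matrix such that $N\boldsymbol u=\boldsymbol u$ for a given vector $\boldsymbol u>0$; moreover, assume that $1$ is a simple eigenvalue of $N$. Let $X_0\in\mathbb R^{n\times n}$ satisfy $X_0\ge 0$ and $X_0\boldsymbol u\le\boldsymbol u$, and let $$X_{k+1}=(2I-X_k)^{-1}N,\quad k=0,1,2,\ldots.$$ Then, for every $k\ge 0$, $X_k\ge 0$, $X_k\boldsymbol u\le\boldsymbol u$, and $2I-X_k$ is a nonsingular M-matrix (in particular, the sequence is well defined). Moreover, $\lim_{k\to\infty}X_k=G$, where $G$ is the minimal nonnegative solution of the matrix equation $X^2-2X+N=0$. Let $\lambda_1,\ldots,\lambda_n$ be the eigenvalues of $G$ (counted with algebraic multiplicity), ordered so that $1=\lambda_1>|\lambda_2|\ge\cdots\ge|\lambda_n|$. If $X_0\boldsymbol u=\boldsymbol u$, then $X_k\boldsymbol u=\boldsymbol u$ for every $k\ge 0$ and $$\limsup_{k\to\infty}\|X_k-G\|^{1/k}\le\sigma,\qquad \sigma=|\lambda_2|.$$ If, in addition to $X_0\boldsymbol u=\boldsymbol u$, one has $\boldsymbol v^\top X_0=\boldsymbol v^\top$, where $\boldsymbol v>0$ is such that $\boldsymbol v^\top N=\boldsymbol v^\top$, then the bound $\limsup_{k\to\infty}\|X_k-G\|^{1/k}\le\sigma$ holds with $$\sigma=\max_{2\le j\le n}\left|\frac{\lambda_2}{2-\lambda_j}\right|.$$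
   Context: All inequalities between real matrices or vectors are entry-wise; $\rho(\cdot)$ denotes the spectral radius. An M-matrix is a real square matrix of the form $\alpha I-B$ with $B\ge 0$, $\alpha>0$ and $\rho(B)\le\alpha$. A minimal nonnegative solution of a matrix equation is a solution $G\ge 0$ such that $G\le Y$ for every solution $Y\ge 0$ of the same equation; for the equation $X^2-2X+N=0$ with $N$ as in the claim such a solution exists. An eigenvalue is simple if it has algebraic multiplicity $1$. $\|\cdot\|$ denotes any matrix norm. *)

theory Defs
  imports
    "Jordan_Normal_Form.Spectral_Radius"
    "HOL-Library.Extended_Real"
begin

(* The library order on matrices and vectors is entrywise and forces equal dimensions, but its
   strict part only means "\<le> and not equal"; strict positivity is therefore defined separately. *)
definition positive_vec :: "real vec \<Rightarrow> bool" where
  "positive_vec u \<longleftrightarrow> (\<forall>i<dim_vec u. 0 < u $ i)"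

abbreviation complex_mat :: "real mat \<Rightarrow> complex mat" where
  "complex_mat A \<equiv> map_mat complex_of_real A"

definition M_matrix :: "nat \<Rightarrow> real mat \<Rightarrow> bool" where
  "M_matrix n A \<longleftrightarrow> (\<exists>\<alpha> B. \<alpha> > 0 \<and> B \<in> carrier_mat n n \<and> 0\<^sub>m n n \<le> B \<and>
     spectral_radius (complex_mat B) \<le> \<alpha> \<and> A = \<alpha> \<cdot>\<^sub>m 1\<^sub>m n - B)"

definition simple_eigenvalue :: "'a :: field mat \<Rightarrow> 'a \<Rightarrow> bool" where
  "simple_eigenvalue A a \<longleftrightarrow> eigenvalue A a \<and> order a (char_poly A) = 1"

definition solution :: "nat \<Rightarrow> real mat \<Rightarrow> real mat \<Rightarrow> bool" where
  "solution n N X \<longleftrightarrow> X \<in> carrier_mat n n \<and> X * X - 2 \<cdot>\<^sub>m X + N = 0\<^sub>m n n"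

definition minimal_nonneg_solution :: "nat \<Rightarrow> real mat \<Rightarrow> real mat \<Rightarrow> bool" where
  "minimal_nonneg_solution n N G \<longleftrightarrow> solution n N G \<and> 0\<^sub>m n n \<le> G \<and>
     (\<forall>Y. solution n N Y \<and> 0\<^sub>m n n \<le> Y \<longrightarrow> G \<le> Y)"

(* Matrices with explicit dimensions carry no topology in the library; convergence is entrywise. *)
definition mat_tendsto :: "nat \<Rightarrow> (nat \<Rightarrow> real mat) \<Rightarrow> real mat \<Rightarrow> bool" where
  "mat_tendsto n X G \<longleftrightarrow> G \<in> carrier_mat n n \<and> (\<forall>k. X k \<in> carrier_mat n n) \<and>
     (\<forall>i<n. \<forall>j<n. (\<lambda>k. X k $$ (i, j)) \<longlonglongrightarrow> G $$ (i, j))"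

(* An arbitrary vector space norm; submultiplicativity is not required. *)
definition matrix_norm :: "nat \<Rightarrow> (real mat \<Rightarrow> real) \<Rightarrow> bool" where
  "matrix_norm n \<nu> \<longleftrightarrow>
     (\<forall>A \<in> carrier_mat n n. 0 \<le> \<nu> A \<and> (\<nu> A = 0 \<longleftrightarrow> A = 0\<^sub>m n n)) \<and>
     (\<forall>c. \<forall>A \<in> carrier_mat n n. \<nu> (c \<cdot>\<^sub>m A) = \<bar>c\<bar> * \<nu> A) \<and>
     (\<forall>A \<in> carrier_mat n n. \<forall>B \<in> carrier_mat n n. \<nu> (A + B) \<le> \<nu> A + \<nu> B)"

(* The eigenvalues are l 1, ..., l n; the factorisation of the characteristic polynomial lists them
   with algebraic multiplicity. Values of l outside {1..n} are irrelevant. *)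
definition ordered_eigenvalues :: "nat \<Rightarrow> real mat \<Rightarrow> (nat \<Rightarrow> complex) \<Rightarrow> bool" where
  "ordered_eigenvalues n A l \<longleftrightarrow>
     char_poly (complex_mat A) = (\<Prod>j=1..n. [:- l j, 1:]) \<and>
     l 1 = 1 \<and> cmod (l 2) < 1 \<and> (\<forall>j\<in>{2..<n}. cmod (l (Suc j)) \<le> cmod (l j))"

end

theory Submission
  imports Defs
begin

text \<open>
  The matrices \<open>X \<ge> 0\<close> with \<open>X u \<le> u\<close> play the role of substochastic matrices: a minimum principle for
  the ratios \<open>z i / u i\<close> shows that \<open>(2I - X) z \<ge> 0\<close> implies \<open>z \<ge> 0\<close>, so \<open>2I - X\<close> is invertible with
  nonnegative inverse and the iteration preserves the class. The iterates \<open>Y k\<close> started at 0 increase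
  to the minimal solution \<open>G\<close>. Since \<open>(I - G)\<^sup>2 = I - N\<close>, simplicity of the eigenvalue 1 of \<open>N\<close>
  forces \<open>G u = u\<close> and makes 1 a simple eigenvalue of \<open>G\<close>, the only one on the unit circle.
  As \<open>Y k \<le> X k\<close> and \<open>(X k - Y k) u \<le> u - Y k u \<rightarrow> 0\<close>, every admissible sequence converges to \<open>G\<close>.

  With \<open>E k = X k - G\<close> and \<open>H k = (2I - X k)\<^sup>-\<^sup>1\<close> one has \<open>E (k + 1) = H k E k G\<close>, hence
  \<open>E k = F k G\<^sup>k\<close> with \<open>F (k + 1) = H k F k\<close>. If \<open>X 0 u = u\<close>, then \<open>F k u = 0\<close>, so \<open>G\<close> may be replaced
  by a deflated matrix with spectral radius \<open>|\<lambda>\<^sub>2|\<close>, while \<open>F k\<close> stays bounded. If moreover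
  \<open>v\<^sup>T F k = 0\<close>, then \<open>H k\<close> may be deflated as well; it is a vanishing perturbation of the deflation
  of \<open>(2I - G)\<^sup>-\<^sup>1\<close>, whose eigenvalues are 0 and the \<open>1 / (2 - \<lambda>\<^sub>j)\<close> with \<open>j \<ge> 2\<close>.
\<close>

section \<open>Nonnegative matrices with a weighted row sum bound\<close>

lemma index_mult_mat_vec_sum:
  assumes "A \<in> carrier_mat n m" "x \<in> carrier_vec m" "i < n"
  shows "(A *\<^sub>v x) $ i = (\<Sum>j<m. A $$ (i, j) * x $ j)"
  using assms by (simp add: scalar_prod_def row_def lessThan_atLeast0)

lemma index_mult_mat_sum:
  assumes "A \<in> carrier_mat n m" "B \<in> carrier_mat m l" "i < n" "j < l"
  shows "(A * B) $$ (i, j) = (\<Sum>k<m. A $$ (i, k) * B $$ (k, j))"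
  using assms by (simp add: scalar_prod_def row_def col_def lessThan_atLeast0)

lemma nonneg_mat_iff:
  "A \<in> carrier_mat n m \<Longrightarrow> 0\<^sub>m n m \<le> A \<longleftrightarrow> (\<forall>i<n. \<forall>j<m. 0 \<le> A $$ (i, j))"
  by (auto simp: less_eq_mat_def)

lemma nonneg_mat_mult:
  fixes A B :: "real mat"
  assumes "A \<in> carrier_mat n m" "B \<in> carrier_mat m l" "0\<^sub>m n m \<le> A" "0\<^sub>m m l \<le> B"
  shows "0\<^sub>m n l \<le> A * B"
  using assms by (auto simp: less_eq_mat_def scalar_prod_def intro!: sum_nonneg)

lemma nonneg_mat_mult_vec_mono:
  fixes A :: "real mat"
  assumes "A \<in> carrier_mat n m" "0\<^sub>m n m \<le> A" "x \<in> carrier_vec m" "x \<le> y"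
  shows "A *\<^sub>v x \<le> A *\<^sub>v y"
  using assms
  by (auto simp: less_eq_mat_def less_eq_vec_def scalar_prod_def intro!: sum_mono mult_left_mono)

lemma diff_mat_nonneg_iff:
  fixes A B :: "real mat"
  assumes "A \<in> carrier_mat n m" "B \<in> carrier_mat n m"
  shows "0\<^sub>m n m \<le> A - B \<longleftrightarrow> B \<le> A"
  using assms by (auto simp: less_eq_mat_def)

text \<open>For positive \<open>u\<close>, conjugation by the diagonal matrix of \<open>u\<close>
  turns such an \<open>X\<close> into a nonnegative matrix with row sums at most 1, which explains
  the name.\<close>

definition substochastic :: "nat \<Rightarrow> real vec \<Rightarrow> real mat \<Rightarrow> bool" where
  "substochastic n u X \<longleftrightarrow> X \<in> carrier_mat n n \<and> 0\<^sub>m n n \<le> X \<and> X *\<^sub>v u \<le> u"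

abbreviation two_minus :: "nat \<Rightarrow> real mat \<Rightarrow> real mat" where
  "two_minus n X \<equiv> 2 \<cdot>\<^sub>m 1\<^sub>m n - X"

abbreviation resolvent :: "nat \<Rightarrow> real mat \<Rightarrow> real mat" where
  "resolvent n X \<equiv> the (mat_inverse (two_minus n X))"

lemma two_minus_mult:
  assumes "X \<in> carrier_mat n n" "Z \<in> carrier_mat n m"
  shows "two_minus n X * Z = 2 \<cdot>\<^sub>m Z - X * Z"
  using assms
  by (subst minus_mult_distrib_mat[of _ n n]) (auto simp: mult_smult_assoc_mat[of _ n n])

lemma two_minus_mult_vec:
  assumes "X \<in> carrier_mat n n" "z \<in> carrier_vec n"
  shows "two_minus n X *\<^sub>v z = 2 \<cdot>\<^sub>v z - X *\<^sub>v z"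
  using assms by (subst minus_mult_distrib_mat_vec[of _ n n]) auto

lemma solution_iff:
  assumes "N \<in> carrier_mat n n"
  shows "solution n N X \<longleftrightarrow> X \<in> carrier_mat n n \<and> two_minus n X * X = N"
proof -
  have "X * X - 2 \<cdot>\<^sub>m X + N = 0\<^sub>m n n \<longleftrightarrow> 2 \<cdot>\<^sub>m X - X * X = N" if X: "X \<in> carrier_mat n n"
  proof -
    define S where "S = X * X"
    have S: "S \<in> carrier_mat n n" using X by (simp add: S_def)
    have "S $$ (i, j) - 2 * X $$ (i, j) + N $$ (i, j) = 0 \<longleftrightarrow> 2 * X $$ (i, j) - S $$ (i, j) = N $$ (i, j)" for i j
      by linarith
    then show ?thesis unfolding S_def[symmetric] using S X assms by (simp add: mat_eq_iff)
  qed
  then show ?thesis unfolding solution_def by (auto simp: two_minus_mult)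
qed

section \<open>Substochastic matrices and the minimum principle for \<open>2I - X\<close>\<close>

locale positive_weight =
  fixes n :: nat and u :: "real vec"
  assumes n_pos: "0 < n" and u_carrier [simp]: "u \<in> carrier_vec n" and positive: "positive_vec u"
begin

lemma u_dim [simp]: "dim_vec u = n"
  using carrier_vecD[OF u_carrier] .

lemma u_pos: "i < n \<Longrightarrow> 0 < u $ i"
  using positive u_carrier by (auto simp: positive_vec_def)

lemma substochasticD:
  assumes "substochastic n u X"
  shows "X \<in> carrier_mat n n" "\<And>i j. i < n \<Longrightarrow> j < n \<Longrightarrow> 0 \<le> X $$ (i, j)"
    "\<And>i. i < n \<Longrightarrow> (\<Sum>j<n. X $$ (i, j) * u $ j) \<le> u $ i" "0\<^sub>m n n \<le> X" "X *\<^sub>v u \<le> u"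
proof -
  show X: "X \<in> carrier_mat n n" and X0: "0\<^sub>m n n \<le> X" and Xu: "X *\<^sub>v u \<le> u"
    using assms by (auto simp: substochastic_def)
  show "0 \<le> X $$ (i, j)" if "i < n" "j < n" for i j
    using X0 X that by (auto simp: less_eq_mat_def)
  show "(\<Sum>j<n. X $$ (i, j) * u $ j) \<le> u $ i" if "i < n" for i
    using Xu X that u_carrier unfolding less_eq_vec_def
    by (auto simp: index_mult_mat_vec_sum[OF X] simp del: index_mult_mat_vec)
qed

text \<open>Cross-multiplied form of the choice of an index where \<open>f j / u $ j\<close> is
  largest. It is applied to the moduli of an eigenvector and to the negated entries of a
  vector.\<close>

lemma maximal_ratio:
  obtains i where "i < n" "\<And>j. j < n \<Longrightarrow> f j * u $ i \<le> f i * u $ j"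
proof -
  let ?r = "\<lambda>j. f j / u $ j"
  have "Max (?r ` {..<n}) \<in> ?r ` {..<n}" using n_pos by (intro Max_in) auto
  then obtain i where i: "i < n" "?r i = Max (?r ` {..<n})" by auto
  have "f j * u $ i \<le> f i * u $ j" if "j < n" for j
  proof -
    have "?r j \<le> ?r i" using that i by simp
    then show ?thesis using u_pos[OF that] u_pos[OF i(1)] by (simp add: field_simps)
  qed
  with i(1) show ?thesis using that by blast
qed

text \<open>In the row where \<open>cmod (x $ i) / u $ i\<close> is largest, the eigenvalue equation
  is dominated by the weighted row sum.\<close>

lemma substochastic_eigenvalue_le_1:
  assumes X: "substochastic n u X" and "eigenvalue (complex_mat X) \<mu>"
  shows "cmod \<mu> \<le> 1"
proof -
  note Xc = substochasticD(1)[OF X]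
  obtain x where x: "x \<in> carrier_vec n" "x \<noteq> 0\<^sub>v n" and ev: "complex_mat X *\<^sub>v x = \<mu> \<cdot>\<^sub>v x"
    using assms(2) Xc unfolding eigenvalue_def eigenvector_def by auto
  obtain i where i: "i < n" "\<And>j. j < n \<Longrightarrow> cmod (x $ j) * u $ i \<le> cmod (x $ i) * u $ j"
    using maximal_ratio[of "\<lambda>j. cmod (x $ j)"] by blast
  have xi: "x $ i \<noteq> 0"
  proof
    assume "x $ i = 0"
    then have "x $ j = 0" if "j < n" for j
      using i(2)[OF that] u_pos[OF i(1)] by (simp add: mult_le_0_iff)
    then have "x = 0\<^sub>v n" using x(1) by auto
    with x(2) show False by simp
  qed
  have "\<mu> * x $ i = (\<Sum>j<n. complex_of_real (X $$ (i, j)) * x $ j)"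
    using arg_cong[OF ev, of "\<lambda>v. v $ i"] i(1) x(1) Xc
    by (simp add: index_mult_mat_vec_sum[of _ n n] del: index_mult_mat_vec)
  then have "cmod \<mu> * cmod (x $ i) \<le> (\<Sum>j<n. X $$ (i, j) * cmod (x $ j))"
    using substochasticD(2)[OF X i(1)]
    by (metis (no_types, lifting) norm_mult norm_of_real abs_of_nonneg sum_norm_le lessThan_iff order_refl)
  then have "cmod \<mu> * cmod (x $ i) * u $ i \<le> (\<Sum>j<n. X $$ (i, j) * cmod (x $ j)) * u $ i"
    using u_pos[OF i(1)] by (intro mult_right_mono) auto
  also have "\<dots> = (\<Sum>j<n. X $$ (i, j) * (cmod (x $ j) * u $ i))"
    by (simp add: sum_distrib_right mult.assoc)
  also have "\<dots> \<le> (\<Sum>j<n. X $$ (i, j) * (cmod (x $ i) * u $ j))"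
    using i substochasticD(2)[OF X] by (intro sum_mono mult_left_mono) auto
  also have "\<dots> = cmod (x $ i) * (\<Sum>j<n. X $$ (i, j) * u $ j)"
    by (simp add: sum_distrib_left mult_ac)
  also have "\<dots> \<le> cmod (x $ i) * u $ i"
    using substochasticD(3)[OF X i(1)] by (intro mult_left_mono) auto
  finally show ?thesis using xi u_pos[OF i(1)] by simp
qed

lemma M_matrix_two_minus:
  assumes X: "substochastic n u X"
  shows "M_matrix n (two_minus n X)"
proof -
  note Xc = substochasticD(1)[OF X]
  have "spectral_radius (complex_mat X) \<in> norm ` spectrum (complex_mat X)"
    using spectral_radius_mem_max(1)[of "complex_mat X" n] n_pos Xc by simp
  then have "spectral_radius (complex_mat X) \<le> 1"
    using substochastic_eigenvalue_le_1[OF X] by (auto simp: spectrum_def)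
  then show ?thesis unfolding M_matrix_def
    using substochasticD(4)[OF X] Xc by (intro exI[of _ 2] exI[of _ X]) auto
qed

text \<open>Minimum principle: let \<open>k\<close> minimise \<open>z $ k / u $ k\<close>. If
  \<open>z $ k\<close> were negative, row \<open>k\<close> would give
  \<open>z $ k * u $ k \<le> 2 * z $ k * u $ k\<close>, which is impossible. So the smallest ratio,
  and with it every entry, is nonnegative.\<close>

lemma two_minus_monotone_vec:
  assumes X: "substochastic n u X" and z: "z \<in> carrier_vec n"
    and nonneg: "\<And>i. i < n \<Longrightarrow> 0 \<le> (two_minus n X *\<^sub>v z) $ i" and "i < n"
  shows "0 \<le> z $ i"
proof -
  note Xc = substochasticD(1)[OF X]
  obtain k where k: "k < n" "\<And>j. j < n \<Longrightarrow> - z $ j * u $ k \<le> - z $ k * u $ j"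
    using maximal_ratio[of "\<lambda>j. - z $ j"] by blast
  have "0 \<le> z $ k"
  proof (rule ccontr)
    assume neg: "\<not> 0 \<le> z $ k"
    have "(\<Sum>j<n. X $$ (k, j) * z $ j) \<le> 2 * z $ k"
      using nonneg[OF k(1)] k(1) Xc z
      by (simp add: two_minus_mult_vec index_mult_mat_vec_sum[of _ n n] del: index_mult_mat_vec)
    then have "(\<Sum>j<n. X $$ (k, j) * z $ j) * u $ k \<le> 2 * z $ k * u $ k"
      using u_pos[OF k(1)] by (intro mult_right_mono) auto
    moreover have "(\<Sum>j<n. X $$ (k, j) * z $ j) * u $ k = (\<Sum>j<n. X $$ (k, j) * (z $ j * u $ k))"
      by (simp add: sum_distrib_right mult.assoc)
    moreover have "(\<Sum>j<n. X $$ (k, j) * (z $ k * u $ j)) \<le> (\<Sum>j<n. X $$ (k, j) * (z $ j * u $ k))"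
      using k substochasticD(2)[OF X] by (intro sum_mono mult_left_mono) auto
    moreover have "(\<Sum>j<n. X $$ (k, j) * (z $ k * u $ j)) = z $ k * (\<Sum>j<n. X $$ (k, j) * u $ j)"
      by (simp add: sum_distrib_left mult_ac)
    moreover have "z $ k * u $ k \<le> z $ k * (\<Sum>j<n. X $$ (k, j) * u $ j)"
      using neg substochasticD(3)[OF X k(1)] by (intro mult_left_mono_neg) auto
    moreover have "z $ k * u $ k < 0" using neg u_pos[OF k(1)] by (simp add: mult_neg_pos)
    ultimately show False by simp
  qed
  then have "- z $ i * u $ k \<le> 0"
    using k(2)[OF \<open>i < n\<close>] u_pos[OF \<open>i < n\<close>]
    by (smt (verit) mult_minus_left mult_nonneg_nonneg)
  then show ?thesis using u_pos[OF k(1)] by (simp add: zero_le_mult_iff)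
qed

lemma two_minus_monotone:
  assumes X: "substochastic n u X" and Z: "Z \<in> carrier_mat n n"
    and "0\<^sub>m n n \<le> two_minus n X * Z"
  shows "0\<^sub>m n n \<le> Z"
proof -
  note Xc = substochasticD(1)[OF X]
  have "0 \<le> Z $$ (i, j)" if ij: "i < n" "j < n" for i j
  proof -
    have "0 \<le> (two_minus n X *\<^sub>v col Z j) $ k" if "k < n" for k
      using assms(3) Z Xc that ij unfolding less_eq_mat_def by auto
    then show ?thesis using two_minus_monotone_vec[OF X, of "col Z j" i] ij Z by auto
  qed
  then show ?thesis using Z by (simp add: nonneg_mat_iff)
qed

text \<open>Monotonicity applied to \<open>v\<close> and \<open>- v\<close> makes the kernel
  trivial, so \<open>the\<close> always meets a \<open>Some\<close>. Applied to the inverse itself,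
  whose image under \<open>2I - X\<close> is the identity, it gives nonnegativity.\<close>

lemma resolvent:
  assumes X: "substochastic n u X"
  shows "resolvent n X \<in> carrier_mat n n" "two_minus n X * resolvent n X = 1\<^sub>m n"
    "resolvent n X * two_minus n X = 1\<^sub>m n" "0\<^sub>m n n \<le> resolvent n X"
    "invertible_mat (two_minus n X)"
proof -
  note Xc = substochasticD(1)[OF X]
  have C: "two_minus n X \<in> carrier_mat n n" using Xc by auto
  have "v = 0\<^sub>v n" if v: "v \<in> carrier_vec n" "two_minus n X *\<^sub>v v = 0\<^sub>v n" for v
  proof -
    have "two_minus n X *\<^sub>v (- v) = 0\<^sub>v n" using v Xc
      by (simp add: two_minus_mult_vec) (auto simp: vec_eq_iff)
    then have "0 \<le> v $ i \<and> 0 \<le> (- v) $ i" if "i < n" for i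
      using two_minus_monotone_vec[OF X, of v] two_minus_monotone_vec[OF X, of "- v"] v that
      by (simp del: index_uminus_vec)
    then show ?thesis using v(1) by (force simp: vec_eq_iff)
  qed
  then have "det (two_minus n X) \<noteq> 0" using det_0_iff_vec_prod_zero[OF C] by auto
  from det_non_zero_imp_unit[OF C this, of "()"] have "mat_inverse (two_minus n X) \<noteq> None"
    using mat_inverse(1)[OF C, of "()"] by blast
  then obtain B where B: "mat_inverse (two_minus n X) = Some B" by auto
  note inv = mat_inverse(2)[OF C B]
  from inv B show H: "resolvent n X \<in> carrier_mat n n" "two_minus n X * resolvent n X = 1\<^sub>m n"
    "resolvent n X * two_minus n X = 1\<^sub>m n" by auto
  show "0\<^sub>m n n \<le> resolvent n X"
    by (rule two_minus_monotone[OF X H(1)]) (simp add: H(2) nonneg_mat_iff[of _ n n])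
  show "invertible_mat (two_minus n X)"
    unfolding invertible_mat_def inverts_mat_def using H Xc by auto
qed

lemma resolvent_mult_vec:
  assumes "substochastic n u X" "z \<in> carrier_vec n"
  shows "resolvent n X *\<^sub>v (two_minus n X *\<^sub>v z) = z"
  using resolvent[OF assms(1)] substochasticD(1)[OF assms(1)] assms(2)
  by (subst assoc_mult_mat_vec[symmetric, of _ n n _ n]) auto

lemma two_minus_resolvent_mult:
  assumes "substochastic n u X" "Z \<in> carrier_mat n m"
  shows "two_minus n X * (resolvent n X * Z) = Z"
  using resolvent[OF assms(1)] substochasticD(1)[OF assms(1)] assms(2)
  by (subst assoc_mult_mat[symmetric, of _ n n _ n]) auto

lemma resolvent_two_minus_mult:
  assumes "substochastic n u X" "Z \<in> carrier_mat n m"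
  shows "resolvent n X * (two_minus n X * Z) = Z"
  using resolvent[OF assms(1)] substochasticD(1)[OF assms(1)] assms(2)
  by (subst assoc_mult_mat[symmetric, of _ n n _ n]) auto

lemma resolvent_fixes_u:
  assumes "substochastic n u X" "X *\<^sub>v u = u"
  shows "resolvent n X *\<^sub>v u = u"
proof -
  have "two_minus n X *\<^sub>v u = u"
    using substochasticD(1)[OF assms(1)] assms(2) u_carrier
    by (simp add: two_minus_mult_vec) (auto simp: vec_eq_iff)
  then show ?thesis using resolvent_mult_vec[OF assms(1) u_carrier] by simp
qed

lemma resolvent_u_le:
  assumes "substochastic n u X"
  shows "resolvent n X *\<^sub>v u \<le> u"
proof -
  note Xc = substochasticD(1)[OF assms]
  have "u \<le> two_minus n X *\<^sub>v u"
    using substochasticD(1,5)[OF assms] u_carrier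
    by (simp add: two_minus_mult_vec) (auto simp: less_eq_vec_def)
  from nonneg_mat_mult_vec_mono[OF resolvent(1,4)[OF assms] u_carrier this]
  show ?thesis using resolvent_mult_vec[OF assms u_carrier] by simp
qed

lemma substochastic_step:
  assumes X: "substochastic n u X" and N: "N \<in> carrier_mat n n" "0\<^sub>m n n \<le> N" "N *\<^sub>v u = u"
  shows "substochastic n u (resolvent n X * N)"
proof -
  have "(resolvent n X * N) *\<^sub>v u = resolvent n X *\<^sub>v u"
    using resolvent(1)[OF X] N by (subst assoc_mult_mat_vec[of _ n n _ n]) auto
  then show ?thesis unfolding substochastic_def
    using resolvent(1,4)[OF X] N resolvent_u_le[OF X] nonneg_mat_mult by auto
qed

text \<open>Subtracting \<open>(2I - Y) Y' = N = (2I - X) X'\<close> gives \<open>(2I - Y) (X' - Y') = (X - Y) X' \<ge> 0\<close>.\<close>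
lemma step_mono:
  assumes Y: "substochastic n u Y" and c: "X \<in> carrier_mat n n" "X' \<in> carrier_mat n n" "Y' \<in> carrier_mat n n"
    and eq: "two_minus n Y * Y' = two_minus n X * X'" and le: "Y \<le> X" and nn: "0\<^sub>m n n \<le> X'"
  shows "Y' \<le> X'"
proof -
  note Yc = substochasticD(1)[OF Y]
  have "two_minus n Y * (X' - Y') = two_minus n Y * X' - two_minus n X * X'"
    using c Yc by (subst mult_minus_distrib_mat[of _ n n]) (auto simp: eq)
  also have "\<dots> = (X - Y) * X'"
  proof -
    define S T where "S = Y * X'" and "T = X * X'"
    have "S \<in> carrier_mat n n" "T \<in> carrier_mat n n" using Yc c by (auto simp: S_def T_def)
    then show ?thesis using c Yc
      by (auto simp: two_minus_mult minus_mult_distrib_mat[of _ n n] S_def[symmetric] T_def[symmetric])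
  qed
  finally have "0\<^sub>m n n \<le> two_minus n Y * (X' - Y')"
    using c Yc le nn diff_mat_nonneg_iff[OF c(1) Yc] by (auto intro!: nonneg_mat_mult[of _ n n])
  from two_minus_monotone[OF Y _ this] show ?thesis using c diff_mat_nonneg_iff by (auto simp: minus_carrier_mat)
qed

end

section \<open>Simple eigenvalues, deflation and powers\<close>

lemma poly_char_poly_det:
  fixes A :: "'a :: field mat"
  assumes "A \<in> carrier_mat n n"
  shows "poly (char_poly A) k = det (k \<cdot>\<^sub>m 1\<^sub>m n - A)"
proof -
  have "- char_matrix A k = k \<cdot>\<^sub>m 1\<^sub>m n - A"
    using assms by (intro eq_matI) (auto simp: char_matrix_def)
  then show ?thesis using char_poly_matrix[OF assms] by simp
qed

text \<open>Simple roots are handled below through a nonvanishing derivative, a condition that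
  passes to the complex characteristic polynomial and can be tested by differentiating
  identities.\<close>

lemma poly_pderiv_simple_root:
  fixes p :: "'a :: field_char_0 poly"
  assumes "p \<noteq> 0" "order a p = 1"
  shows "poly (pderiv p) a \<noteq> 0"
proof (cases "pderiv p = 0")
  case True
  then obtain c where "p = [:c:]" by (auto simp: pderiv_eq_0_iff elim: degree_eq_zeroE)
  then show ?thesis using assms by (simp add: order_0I)
next
  case False
  then have "order a p = Suc (order a (pderiv p))" using assms order_root[of p a] by (intro order_pderiv) auto
  then show ?thesis using assms False by (simp add: order_root)
qed

text \<open>If the eigenspace had dimension at least two, it would contain, for every \<open>i\<close>, a nonzero
  vector vanishing at \<open>i\<close>; this is an eigenvector of the matrix with row and column \<open>i\<close> erased,
  and the derivative of the characteristic polynomial is a sum over these erased matrices.\<close>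
lemma simple_root_eigenspace:
  fixes A :: "'a :: field mat"
  assumes A: "A \<in> carrier_mat n n" and k: "k \<noteq> 0" "poly (pderiv (char_poly A)) k \<noteq> 0"
    and x: "x \<in> carrier_vec n" "A *\<^sub>v x = k \<cdot>\<^sub>v x"
    and y: "y \<in> carrier_vec n" "A *\<^sub>v y = k \<cdot>\<^sub>v y" "y \<noteq> 0\<^sub>v n"
  shows "\<exists>c. x = c \<cdot>\<^sub>v y"
proof (rule ccontr)
  assume indep: "\<not> ?thesis"
  have "poly (char_poly (mat_erase A i i)) k = 0" if i: "i < n" for i
  proof -
    obtain z where z: "z \<in> carrier_vec n" "A *\<^sub>v z = k \<cdot>\<^sub>v z" "z \<noteq> 0\<^sub>v n" "z $ i = 0"
    proof (cases "y $ i = 0")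
      case True
      then show ?thesis using that y by blast
    next
      case False
      \<comment> \<open>The combination of \<open>x\<close> and \<open>y\<close> whose entry
        \<open>i\<close> cancels; it is nonzero because \<open>x\<close> is not a multiple of
        \<open>y\<close>.\<close>
      define z where "z = x - (x $ i / y $ i) \<cdot>\<^sub>v y"
      have zc: "z \<in> carrier_vec n" using x y by (simp add: z_def)
      have "z \<noteq> 0\<^sub>v n"
      proof
        assume "z = 0\<^sub>v n"
        then have "x = (x $ i / y $ i) \<cdot>\<^sub>v y" using x(1) y(1) unfolding z_def
          by (metis (no_types, lifting) carrier_vecD eq_vecI index_minus_vec(1) index_smult_vec(2)
              index_zero_vec(1) right_minus_eq)
        with indep show False by blast
      qed
      moreover have "A *\<^sub>v z = k \<cdot>\<^sub>v z"
        using A x y unfolding z_def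
        by (subst mult_minus_distrib_mat_vec[of _ n n])
           (auto simp: mult_mat_vec[of _ n n] vec_eq_iff algebra_simps)
      moreover have "z $ i = 0" using False i x y by (simp add: z_def)
      ultimately show ?thesis using that zc by blast
    qed
    have "mat_erase A i i *\<^sub>v z = k \<cdot>\<^sub>v z"
    proof (rule eq_vecI)
      fix m assume "m < dim_vec (k \<cdot>\<^sub>v z)"
      then have m: "m < n" using z by simp
      have e: "(mat_erase A i i *\<^sub>v z) $ m = (\<Sum>j<n. mat_erase A i i $$ (m, j) * z $ j)"
        using A z m by (simp add: scalar_prod_def mat_erase_def row_def lessThan_atLeast0)
      show "(mat_erase A i i *\<^sub>v z) $ m = (k \<cdot>\<^sub>v z) $ m"
      proof (cases "m = i")
        case True
        \<comment> \<open>Row \<open>i\<close> of the erased matrix is zero, and so is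
          \<open>z $ i\<close>.\<close>
        then show ?thesis using e A z m by (simp add: mat_erase_def)
      next
        case False
        have "(\<Sum>j<n. mat_erase A i i $$ (m, j) * z $ j) = (\<Sum>j<n. A $$ (m, j) * z $ j)"
          using A m False z by (intro sum.cong) (auto simp: mat_erase_def)
        also have "\<dots> = (A *\<^sub>v z) $ m"
          using A m z(1) by (simp add: scalar_prod_def row_def lessThan_atLeast0)
        finally show ?thesis using e z(2) by simp
      qed
    qed (use A z in \<open>auto simp: mat_erase_def\<close>)
    then have "eigenvalue (mat_erase A i i) k"
      unfolding eigenvalue_def eigenvector_def using z A by (intro exI[of _ z]) (auto simp: mat_erase_def)
    then show ?thesis using eigenvalue_root_char_poly[of "mat_erase A i i" n k] A by simp
  qed
  \<comment> \<open>\<open>mat_erase\<close> zeroes a row and a column but keeps the dimension, so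
    every summand carries an extra factor of the indeterminate. Dividing by it is where
    \<open>k \<noteq> 0\<close> enters.\<close>
  then have "poly (monom 1 1 * pderiv (char_poly A)) k = 0"
    unfolding pderiv_char_poly_mat_erase[OF A] by (simp add: poly_sum)
  then show False using k by (simp add: poly_monom)
qed

lemma simple_eigenvalue_complex:
  assumes A: "A \<in> carrier_mat n n" and "simple_eigenvalue A a"
  shows "poly (pderiv (char_poly (complex_mat A))) (complex_of_real a) \<noteq> 0"
proof -
  have "poly (pderiv (char_poly A)) a \<noteq> 0"
    using assms degree_monic_char_poly[OF A]
    by (intro poly_pderiv_simple_root) (auto simp: simple_eigenvalue_def)
  then show ?thesis
    by (simp add: of_real_hom.char_poly_hom[OF A] of_real_hom.map_poly_pderiv[symmetric])
qed

text \<open>Take determinants in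
  \<open>(z I - G) ((2 - z) I - G) = (2 z - z^2) I - (2 G - G^2)\<close>; agreement at all points of
  an infinite field gives equality of polynomials. Here \<open>[:0, 2, -1:]\<close> is
  \<open>2 z - z^2\<close> and \<open>[:2, -1:]\<close> is \<open>2 - z\<close>.\<close>

lemma char_poly_quadratic:
  fixes G :: "'a :: field_char_0 mat"
  assumes G: "G \<in> carrier_mat n n"
  shows "char_poly (2 \<cdot>\<^sub>m G - G * G) \<circ>\<^sub>p [:0, 2, -1:] = char_poly G * (char_poly G \<circ>\<^sub>p [:2, -1:])"
proof -
  define S where "S = G * G"
  have S: "S \<in> carrier_mat n n" using G by (simp add: S_def)
  have "poly (char_poly (2 \<cdot>\<^sub>m G - S)) (2 * z - z * z) = poly (char_poly G) z * poly (char_poly G) (2 - z)" for z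
  proof -
    define V where "V = (2 - z) \<cdot>\<^sub>m 1\<^sub>m n - G"
    have V: "V \<in> carrier_mat n n" and zG: "z \<cdot>\<^sub>m 1\<^sub>m n - G \<in> carrier_mat n n"
      using G by (auto simp: V_def)
    have GV: "G * V = (2 - z) \<cdot>\<^sub>m G - S"
      unfolding V_def S_def using G
      by (subst mult_minus_distrib_mat[of _ n n]) (auto simp: mult_smult_distrib[of _ n n])
    have "(z \<cdot>\<^sub>m 1\<^sub>m n - G) * V = z \<cdot>\<^sub>m V - G * V"
      using G V by (subst minus_mult_distrib_mat[of _ n n]) (auto simp: mult_smult_assoc_mat[of _ n n])
    also have "\<dots> = (2 * z - z * z) \<cdot>\<^sub>m 1\<^sub>m n - (2 \<cdot>\<^sub>m G - S)"
      unfolding GV unfolding V_def using G S by (intro eq_matI) (auto simp: algebra_simps)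
    finally have "(2 * z - z * z) \<cdot>\<^sub>m 1\<^sub>m n - (2 \<cdot>\<^sub>m G - S) = (z \<cdot>\<^sub>m 1\<^sub>m n - G) * V" by simp
    moreover have "2 \<cdot>\<^sub>m G - S \<in> carrier_mat n n" using G S by auto
    ultimately show ?thesis
      using det_mult[OF zG V] by (simp add: poly_char_poly_det[OF G] poly_char_poly_det V_def)
  qed
  then have "poly (char_poly (2 \<cdot>\<^sub>m G - S) \<circ>\<^sub>p [:0, 2, -1:]) = poly (char_poly G * (char_poly G \<circ>\<^sub>p [:2, -1:]))"
    by (intro ext) (simp add: poly_pcompose algebra_simps)
  then show ?thesis unfolding S_def by (simp only: poly_eq_poly_eq_iff)
qed

text \<open>Compare second derivatives at 1 in \<open>char_poly_quadratic\<close>.\<close>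
lemma simple_root_quadratic:
  fixes G :: "'a :: field_char_0 mat"
  assumes G: "G \<in> carrier_mat n n" and root: "poly (char_poly G) 1 = 0"
    and "poly (pderiv (char_poly (2 \<cdot>\<^sub>m G - G * G))) 1 \<noteq> 0"
  shows "poly (pderiv (char_poly G)) 1 \<noteq> 0"
proof
  assume z: "poly (pderiv (char_poly G)) 1 = 0"
  \<comment> \<open>At 1 the inner polynomial \<open>2 z - z^2\<close> has value 1, first derivative
    0 and second derivative -2, so only the first derivative of the outer polynomial survives on the
    left. A double root of \<open>char_poly G\<close> annihilates the right side.\<close>
  from arg_cong[OF char_poly_quadratic[OF G], of "\<lambda>p. poly (pderiv (pderiv p)) 1"]
  have "poly (pderiv (char_poly (2 \<cdot>\<^sub>m G - G * G))) 1 * 2 = 0"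
    using root z by (simp add: pderiv_mult pderiv_pcompose pderiv_pCons poly_pcompose pderiv_add
        pderiv_diff pderiv_minus pderiv_smult)
  with assms(3) show False by simp
qed

text \<open>Wielandt deflation: subtracting \<open>u w\<^sup>T\<close> moves the eigenvalue 1 to 0.\<close>
definition deflate :: "nat \<Rightarrow> 'a :: ring mat \<Rightarrow> 'a vec \<Rightarrow> 'a vec \<Rightarrow> 'a mat" where
  "deflate n M u w = M - mat n n (\<lambda>(i, j). u $ i * w $ j)"

lemma deflate_carrier [simp]: "deflate n M u w \<in> carrier_mat n n"
  unfolding deflate_def by (rule carrier_matI) auto

lemma deflate_mult_vec:
  fixes M :: "'a :: comm_ring mat"
  assumes "M \<in> carrier_mat n n" "u \<in> carrier_vec n" "w \<in> carrier_vec n" "x \<in> carrier_vec n"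
  shows "deflate n M u w *\<^sub>v x = M *\<^sub>v x - (w \<bullet> x) \<cdot>\<^sub>v u"
proof -
  have "mat n n (\<lambda>(i, j). u $ i * w $ j) *\<^sub>v x = (w \<bullet> x) \<cdot>\<^sub>v u"
    using assms by (intro eq_vecI) (auto simp: scalar_prod_def sum_distrib_left mult_ac)
  then show ?thesis unfolding deflate_def using assms
    by (subst minus_mult_distrib_mat_vec[of _ n n]) auto
qed

text \<open>The hypothesis \<open>kernel\<close> says that the kernel of \<open>(M - I)^2\<close> is
  spanned by \<open>u\<close>, which expresses algebraic simplicity of 1 through vectors alone. An
  eigenvector of the deflated matrix becomes one of \<open>M\<close> after subtraction of a multiple
  of \<open>u\<close>.\<close>

lemma deflate_eigenvalue:
  fixes M :: "'a :: field mat"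
  assumes M: "M \<in> carrier_mat n n" and u: "u \<in> carrier_vec n" and w: "w \<in> carrier_vec n"
    and fix_u: "M *\<^sub>v u = u" and wu: "w \<bullet> u = 1"
    and kernel: "\<And>x. x \<in> carrier_vec n \<Longrightarrow> M *\<^sub>v (M *\<^sub>v x - x) = M *\<^sub>v x - x \<Longrightarrow> \<exists>a. x = a \<cdot>\<^sub>v u"
    and ev: "eigenvalue (deflate n M u w) \<mu>" and "\<mu> \<noteq> 0"
  shows "\<mu> \<noteq> 1" "eigenvalue M \<mu>"
proof -
  obtain x where x: "x \<in> carrier_vec n" "x \<noteq> 0\<^sub>v n" "deflate n M u w *\<^sub>v x = \<mu> \<cdot>\<^sub>v x"
    using ev unfolding eigenvalue_def eigenvector_def by (auto simp: deflate_def)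
  define c where "c = w \<bullet> x"
  have entry: "(M *\<^sub>v x) $ i = \<mu> * x $ i + c * u $ i" if "i < n" for i
    using arg_cong[OF x(3), of "\<lambda>v. v $ i"] that M u w x(1)
    by (simp add: deflate_mult_vec c_def algebra_simps)
  have Mx: "M *\<^sub>v x = \<mu> \<cdot>\<^sub>v x + c \<cdot>\<^sub>v u"
    using entry M u x(1) by (intro eq_vecI) auto
  have u0: "u \<noteq> 0\<^sub>v n" using wu w by auto
  show mu1: "\<mu> \<noteq> 1"
  proof
    assume 1: "\<mu> = 1"
    \<comment> \<open>\<open>M x - x\<close> is fixed by \<open>M\<close>, so \<open>kernel\<close>
      makes \<open>x\<close> a multiple \<open>a u\<close>. This line then gives
      \<open>c = 0\<close>, while pairing with \<open>w\<close> gives \<open>c = a\<close>, so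
      \<open>x\<close> would vanish.\<close>
    have d: "M *\<^sub>v x - x = c \<cdot>\<^sub>v u" using entry 1 M u x(1) by (intro eq_vecI) auto
    then have "M *\<^sub>v (M *\<^sub>v x - x) = M *\<^sub>v x - x" using M u fix_u by (simp add: mult_mat_vec[of _ n n])
    then obtain a where a: "x = a \<cdot>\<^sub>v u" using kernel x(1) by blast
    then have "M *\<^sub>v x - x = 0\<^sub>v n" using M u fix_u by (simp add: mult_mat_vec[of _ n n])
    with d u0 u have "c = 0" by (auto simp: vec_eq_iff)
    moreover have "c = a" unfolding c_def a using w u wu by simp
    ultimately show False using a x(2) u by auto
  qed
  \<comment> \<open>The multiple of \<open>u\<close> is chosen to cancel the term \<open>c u\<close>
    in \<open>M x = \<mu> x + c u\<close>.\<close>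
  define y where "y = x - (c / (1 - \<mu>)) \<cdot>\<^sub>v u"
  have yc: "y \<in> carrier_vec n" using x u by (simp add: y_def)
  have "M *\<^sub>v y = M *\<^sub>v x - (c / (1 - \<mu>)) \<cdot>\<^sub>v u"
    unfolding y_def using M x(1) u fix_u
    by (subst mult_minus_distrib_mat_vec[of _ n n]) (auto simp: mult_mat_vec[of _ n n])
  also have "\<dots> = \<mu> \<cdot>\<^sub>v y"
  proof -
    have "\<mu> * a + c * b - c / (1 - \<mu>) * b = \<mu> * (a - c / (1 - \<mu>) * b)" for a b
      using mu1 by (simp add: divide_simps) (simp add: algebra_simps)
    then show ?thesis unfolding y_def Mx using x(1) u by (intro eq_vecI) auto
  qed
  finally have "M *\<^sub>v y = \<mu> \<cdot>\<^sub>v y" .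
  moreover have "y \<noteq> 0\<^sub>v n"
  proof
    assume "y = 0\<^sub>v n"
    then have xu: "x = (c / (1 - \<mu>)) \<cdot>\<^sub>v u" using x(1) u unfolding y_def by (auto simp: vec_eq_iff)
    \<comment> \<open>Pairing \<open>x\<close> with \<open>w\<close> gives two expressions for
      \<open>c\<close>; as \<open>\<mu> \<noteq> 0\<close>, they agree only for
      \<open>c = 0\<close>.\<close>
    have "c = c / (1 - \<mu>)" using c_def w u wu by (subst (asm) xu) simp
    then have "c = 0" using mu1 \<open>\<mu> \<noteq> 0\<close> by (auto simp: divide_simps)
    with xu x(2) u show False by auto
  qed
  ultimately show "eigenvalue M \<mu>" unfolding eigenvalue_def eigenvector_def using M yc by auto
qed

section \<open>Growth of matrix powers\<close>

lemma smult_pow_mat: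
  fixes A :: "'a :: comm_semiring_1 mat"
  assumes A: "A \<in> carrier_mat n n"
  shows "(c \<cdot>\<^sub>m A) ^\<^sub>m k = c ^ k \<cdot>\<^sub>m A ^\<^sub>m k"
proof (induction k)
  case 0
  then show ?case using A by (intro eq_matI) auto
next
  case (Suc k)
  have P: "A ^\<^sub>m k \<in> carrier_mat n n" using A by simp
  have "(c ^ k \<cdot>\<^sub>m A ^\<^sub>m k) * (c \<cdot>\<^sub>m A) = c \<cdot>\<^sub>m (c ^ k \<cdot>\<^sub>m (A ^\<^sub>m k * A))"
    using A P by (subst mult_smult_distrib[of _ n n _ n]) (auto simp: mult_smult_assoc_mat[of _ n n _ n])
  also have "\<dots> = c ^ Suc k \<cdot>\<^sub>m (A ^\<^sub>m k * A)" by (intro eq_matI) (auto simp: mult.assoc)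
  finally show ?case by (simp add: Suc)
qed

text \<open>Division by \<open>t\<close> brings all eigenvalues strictly inside the unit disc, where
  powers stay bounded. The gap between \<open>s\<close> and \<open>t\<close> absorbs the polynomial
  growth caused by Jordan blocks.\<close>

lemma pow_mat_bound:
  fixes Q :: "real mat"
  assumes Q: "Q \<in> carrier_mat n n" and n: "0 < n"
    and ev: "\<And>\<mu>. eigenvalue (complex_mat Q) \<mu> \<Longrightarrow> cmod \<mu> \<le> s" and "s < t" "0 < t"
  shows "\<exists>C\<ge>0. \<forall>k. norm_bound (Q ^\<^sub>m k) (C * t ^ k)"
proof -
  define A where "A = complex_mat ((1 / t) \<cdot>\<^sub>m Q)"
  have A: "A \<in> carrier_mat n n" using Q by (simp add: A_def)
  have Q_eq: "complex_mat Q = complex_of_real t \<cdot>\<^sub>m A"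
    using Q \<open>0 < t\<close> by (intro eq_matI) (auto simp: A_def)
  have "cmod \<mu> < 1" if \<mu>: "eigenvalue A \<mu>" for \<mu>
  proof -
    obtain x where x: "x \<in> carrier_vec n" "x \<noteq> 0\<^sub>v n" "A *\<^sub>v x = \<mu> \<cdot>\<^sub>v x"
      using \<mu> A unfolding eigenvalue_def eigenvector_def by auto
    have "complex_mat Q *\<^sub>v x = complex_of_real t \<cdot>\<^sub>v (A *\<^sub>v x)"
      unfolding Q_eq using x(1) A by (intro eq_vecI) auto
    then have "complex_mat Q *\<^sub>v x = (t * \<mu>) \<cdot>\<^sub>v x"
      using x(3) by (simp add: smult_smult_assoc)
    then have "eigenvalue (complex_mat Q) (t * \<mu>)"
      unfolding eigenvalue_def eigenvector_def using x Q by auto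
    from ev[OF this] have "t * cmod \<mu> \<le> s" using \<open>0 < t\<close> by (simp add: norm_mult)
    with \<open>s < t\<close> have "t * cmod \<mu> < t * 1" by simp
    then show ?thesis using \<open>0 < t\<close> by (simp only: mult_less_cancel_left_pos)
  qed
  moreover have "spectral_radius A \<in> norm ` spectrum A" using spectral_radius_mem_max(1)[OF A n] .
  ultimately have "spectral_radius A < 1" by (auto simp: spectrum_def)
  from spectral_radius_jnf_norm_bound_less_1_upper_triangular[OF A this]
  obtain c where c: "\<And>k. norm_bound (A ^\<^sub>m k) c" by blast
  have "norm_bound (Q ^\<^sub>m k) (max c 0 * t ^ k)" for k
  proof
    fix i j assume "i < dim_row (Q ^\<^sub>m k)" "j < dim_col (Q ^\<^sub>m k)"
    then have ij: "i < n" "j < n" using Q by (auto split: if_splits)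
    have Qk: "Q ^\<^sub>m k \<in> carrier_mat n n" and Ak: "A ^\<^sub>m k \<in> carrier_mat n n"
      using Q A by auto
    have "complex_mat (Q ^\<^sub>m k) = complex_of_real t ^ k \<cdot>\<^sub>m A ^\<^sub>m k"
      unfolding of_real_hom.mat_hom_pow[OF Q] Q_eq by (rule smult_pow_mat[OF A])
    from arg_cong[OF this, of "\<lambda>M. M $$ (i, j)"]
    have "complex_of_real ((Q ^\<^sub>m k) $$ (i, j)) = complex_of_real t ^ k * (A ^\<^sub>m k) $$ (i, j)"
      using ij Q A by simp
    then have "\<bar>(Q ^\<^sub>m k) $$ (i, j)\<bar> = t ^ k * cmod ((A ^\<^sub>m k) $$ (i, j))"
      using \<open>0 < t\<close> by (metis norm_mult norm_of_real norm_power abs_of_pos)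
    also have "\<dots> \<le> t ^ k * max c 0"
    proof (intro mult_left_mono)
      show "cmod ((A ^\<^sub>m k) $$ (i, j)) \<le> max c 0"
        using c[of k] ij A by (simp add: norm_bound_def le_max_iff_disj)
    qed (use \<open>0 < t\<close> in simp)
    finally show "norm ((Q ^\<^sub>m k) $$ (i, j)) \<le> max c 0 * t ^ k" by (simp add: mult.commute)
  qed
  then show ?thesis by (intro exI[of _ "max c 0"]) auto
qed

section \<open>Perturbed products, matrix norms and ordered eigenvalues\<close>

lemma norm_bound_add:
  assumes "A \<in> carrier_mat n m" "B \<in> carrier_mat n m" "norm_bound A a" "norm_bound B b"
  shows "norm_bound (A + B) (a + b)"
  using assms unfolding norm_bound_def
  by (auto intro!: order_trans[OF norm_triangle_ineq] add_mono)

lemma norm_bound_mono: "norm_bound A a \<Longrightarrow> a \<le> b \<Longrightarrow> norm_bound A b"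
  unfolding norm_bound_def by (meson order_trans)

text \<open>Since \<open>P\<close> is controlled through its powers,
  \<open>P ^\<^sub>m m * F k\<close> is bounded for all \<open>m\<close> at once. In the induction
  step one summand raises \<open>m\<close> and contributes \<open>t\<close>; the other contributes
  \<open>C * \<delta> * n * n\<close>, each \<open>n\<close> coming from the entrywise bound of a
  product.\<close>

lemma perturbed_product_bound:
  fixes P :: "real mat"
  assumes P: "P \<in> carrier_mat n n" and D: "\<And>k. D k \<in> carrier_mat n n" and F: "\<And>k. F k \<in> carrier_mat n n"
    and P_bound: "\<And>m. norm_bound (P ^\<^sub>m m) (C * t ^ m)"
    and D_bound: "\<And>k. norm_bound (D k) \<delta>" and F_bound: "norm_bound (F 0) f"
    and step: "\<And>k. F (Suc k) = (P + D k) * F k"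
  shows "norm_bound (P ^\<^sub>m m * F k) (n * C * f * t ^ m * (t + C * \<delta> * n * n) ^ k)"
proof (induction k arbitrary: m)
  case 0
  show ?case using norm_bound_mult[OF pow_carrier_mat[OF P] F P_bound F_bound, of m] by (simp add: mult_ac)
next
  case (Suc k)
  have DF: "D k * F k \<in> carrier_mat n n" and PF: "P * F k \<in> carrier_mat n n"
    and Pm: "P ^\<^sub>m m \<in> carrier_mat n n"
    using mult_carrier_mat[OF D F] mult_carrier_mat[OF P F] P by auto
  have "norm_bound (F k) (n * C * f * (t + C * \<delta> * n * n) ^ k)"
    using Suc.IH[of 0] P F[of k] by simp
  from norm_bound_mult[OF D F D_bound this]
  have "norm_bound (P ^\<^sub>m m * (D k * F k))
      (C * t ^ m * (\<delta> * (n * C * f * (t + C * \<delta> * n * n) ^ k) * n) * n)"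
    by (rule norm_bound_mult[OF Pm DF P_bound])
  from norm_bound_add[OF _ _ Suc.IH[of "Suc m"] this, of n n]
  have "norm_bound (P ^\<^sub>m Suc m * F k + P ^\<^sub>m m * (D k * F k))
      (n * C * f * t ^ m * (t + C * \<delta> * n * n) ^ Suc k)"
    using mult_carrier_mat[OF mult_carrier_mat[OF Pm P] F[of k]] mult_carrier_mat[OF Pm DF]
    by (simp add: algebra_simps)
  moreover have "P ^\<^sub>m m * F (Suc k) = P ^\<^sub>m Suc m * F k + P ^\<^sub>m m * (D k * F k)"
  proof -
    have "F (Suc k) = P * F k + D k * F k"
      unfolding step using P D F by (intro add_mult_distrib_mat) auto
    then have "P ^\<^sub>m m * F (Suc k) = P ^\<^sub>m m * (P * F k) + P ^\<^sub>m m * (D k * F k)"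
      using mult_add_distrib_mat[OF Pm PF DF] by simp
    then show ?thesis using assoc_mult_mat[OF Pm P F[of k]] by simp
  qed
  ultimately show ?case by simp
qed

text \<open>Expansion in matrix units; the constant is the sum of their norms. This transfers
  entrywise estimates to an arbitrary norm.\<close>

lemma matrix_norm_le_entries:
  assumes \<nu>: "matrix_norm n \<nu>"
  shows "\<exists>K\<ge>0. \<forall>A\<in>carrier_mat n n. \<forall>b. norm_bound A b \<longrightarrow> \<nu> A \<le> K * b"
proof -
  have zero: "\<nu> (0\<^sub>m n n) = 0" and nonneg: "\<And>A. A \<in> carrier_mat n n \<Longrightarrow> 0 \<le> \<nu> A"
    and smult: "\<And>c A. A \<in> carrier_mat n n \<Longrightarrow> \<nu> (c \<cdot>\<^sub>m A) = \<bar>c\<bar> * \<nu> A"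
    and add: "\<And>A B. A \<in> carrier_mat n n \<Longrightarrow> B \<in> carrier_mat n n \<Longrightarrow> \<nu> (A + B) \<le> \<nu> A + \<nu> B"
    using \<nu> unfolding matrix_norm_def by auto
  define unit where "unit p = mat n n (\<lambda>q. if q = p then 1 else 0 :: real)" for p
  have unit_c: "unit p \<in> carrier_mat n n" for p by (simp add: unit_def)
  define part where "part A S = mat n n (\<lambda>q. if q \<in> S then A $$ q else 0)" for A :: "real mat" and S
  have "\<nu> (part A S) \<le> (\<Sum>p\<in>S. \<bar>A $$ p\<bar> * \<nu> (unit p))" if "finite S" for A S
    using that
  proof (induction S rule: finite_induct)
    case empty
    have "part A {} = 0\<^sub>m n n" by (intro eq_matI) (auto simp: part_def)
    then show ?case using zero by simp
  next
    case (insert p S)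
    have "part A (insert p S) = (A $$ p) \<cdot>\<^sub>m unit p + part A S"
      using insert.hyps by (intro eq_matI) (auto simp: part_def unit_def)
    moreover have "part A S \<in> carrier_mat n n" by (simp add: part_def)
    ultimately have "\<nu> (part A (insert p S)) \<le> \<bar>A $$ p\<bar> * \<nu> (unit p) + \<nu> (part A S)"
      using add[of "(A $$ p) \<cdot>\<^sub>m unit p" "part A S"] smult[OF unit_c] unit_c by simp
    then show ?case using insert by simp
  qed
  note part_le = this
  define K where "K = (\<Sum>p\<in>{..<n} \<times> {..<n}. \<nu> (unit p))"
  have "\<nu> A \<le> K * b" if A: "A \<in> carrier_mat n n" and b: "norm_bound A b" for A b
  proof -
    have "A = part A ({..<n} \<times> {..<n})" using A by (intro eq_matI) (auto simp: part_def)
    then have "\<nu> A \<le> (\<Sum>p\<in>{..<n} \<times> {..<n}. \<bar>A $$ p\<bar> * \<nu> (unit p))"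
      using part_le[of "{..<n} \<times> {..<n}" A] by simp
    also have "\<dots> \<le> (\<Sum>p\<in>{..<n} \<times> {..<n}. b * \<nu> (unit p))"
      using A b nonneg[OF unit_c] by (intro sum_mono mult_right_mono) (auto simp: norm_bound_def)
    finally show ?thesis by (simp add: K_def sum_distrib_left mult.commute)
  qed
  moreover have "0 \<le> K" unfolding K_def using nonneg[OF unit_c] by (intro sum_nonneg) auto
  ultimately show ?thesis by blast
qed

text \<open>The constant disappears because its \<open>k\<close>-th roots tend to 1 once it is
  replaced by \<open>max C 1\<close>; the limsup is then at most every rate above
  \<open>\<sigma>\<close>.\<close>

lemma limsup_root_le:
  fixes e :: "nat \<Rightarrow> real"
  assumes e: "\<And>k. 0 \<le> e k" and "0 \<le> \<sigma>"
    and bound: "\<And>r. \<sigma> < r \<Longrightarrow> \<exists>C. \<forall>\<^sub>F k in sequentially. e k \<le> C * r ^ k"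
  shows "limsup (\<lambda>k. ereal (e k powr (1 / real k))) \<le> ereal \<sigma>"
proof (rule ereal_le_epsilon2)
  fix \<epsilon> :: real assume "0 < \<epsilon>"
  define r where "r = \<sigma> + \<epsilon>"
  have r: "0 < r" "\<sigma> < r" using \<open>0 \<le> \<sigma>\<close> \<open>0 < \<epsilon>\<close> by (auto simp: r_def)
  obtain C where C: "\<forall>\<^sub>F k in sequentially. e k \<le> C * r ^ k" using bound[OF r(2)] by blast
  define B where "B = max C 1"
  have "B \<noteq> 0" by (simp add: B_def max_def)
  then have "(\<lambda>k. B powr (1 / real k)) \<longlonglongrightarrow> B powr 0"
    by (intro tendsto_powr tendsto_const lim_1_over_n)
  then have "(\<lambda>k. B powr (1 / real k) * r) \<longlonglongrightarrow> B powr 0 * r" by (rule tendsto_mult_right)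
  then have "(\<lambda>k. B powr (1 / real k) * r) \<longlonglongrightarrow> r" using \<open>B \<noteq> 0\<close> by simp
  then have "limsup (\<lambda>k. ereal (B powr (1 / real k) * r)) = ereal r"
    by (intro lim_imp_Limsup) (auto simp: tendsto_ereal)
  moreover have "limsup (\<lambda>k. ereal (e k powr (1 / real k))) \<le> limsup (\<lambda>k. ereal (B powr (1 / real k) * r))"
  proof (rule Limsup_mono)
    show "\<forall>\<^sub>F k in sequentially. ereal (e k powr (1 / real k)) \<le> ereal (B powr (1 / real k) * r)"
      \<comment> \<open>Index 0 is left out, since \<open>1 / real 0\<close> is 0.\<close>
      using C eventually_gt_at_top[of 0]
    proof eventually_elim
      case (elim k)
      have "e k \<le> B * r ^ k" using elim(1) r(1)
        by (smt (verit) B_def max.cobounded1 mult_right_mono zero_le_power)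
      then have "e k powr (1 / real k) \<le> (B * r ^ k) powr (1 / real k)"
        using e by (intro powr_mono2) auto
      also have "\<dots> = B powr (1 / real k) * r"
        using r(1) elim(2) by (simp add: B_def powr_mult powr_realpow[symmetric] powr_powr)
      finally show ?case by simp
    qed
  qed
  ultimately show "limsup (\<lambda>k. ereal (e k powr (1 / real k))) \<le> ereal \<sigma> + ereal \<epsilon>"
    by (simp add: r_def)
qed

text \<open>The characteristic polynomial splits over the complex numbers; one copy of 1 is moved to
  the front and the rest is sorted by decreasing modulus. Simplicity of the root 1 keeps it out of
  the rest.\<close>

lemma ordered_eigenvalues_exist:
  assumes G: "G \<in> carrier_mat n n" and "2 \<le> n"
    and root: "poly (char_poly (complex_mat G)) 1 = 0"
    and simple: "poly (pderiv (char_poly (complex_mat G))) 1 \<noteq> 0"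
    and others: "\<And>\<mu>. poly (char_poly (complex_mat G)) \<mu> = 0 \<Longrightarrow> \<mu> \<noteq> 1 \<Longrightarrow> cmod \<mu> < 1"
  shows "\<exists>l. ordered_eigenvalues n G l"
proof -
  let ?\<chi> = "char_poly (complex_mat G)"
  obtain as where as: "?\<chi> = (\<Prod>a\<leftarrow>as. [:- a, 1:])" "length as = n"
    using char_poly_factorized[of "complex_mat G" n] G by auto
  have "(\<Prod>a\<leftarrow>as. poly [:- a, 1:] 1) = 0" using root as by (simp add: poly_prod_list o_def)
  then have 1: "1 \<in> set as" by (auto simp: prod_list_zero_iff)
  define bs where "bs = sort_key (\<lambda>z. - cmod z) (remove1 1 as)"
  define ls where "ls = 1 # bs"
  have mset: "mset ls = mset as" using 1 by (simp add: ls_def bs_def)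
  then have len: "length ls = n" using as(2) mset_eq_length by blast
  have "mset (map (\<lambda>a. [:- a, 1:]) ls) = mset (map (\<lambda>a. [:- a, 1:]) as)" using mset by simp
  then have \<chi>: "?\<chi> = (\<Prod>a\<leftarrow>ls. [:- a, 1:])" using as(1) by (metis prod_mset_prod_list)
  have bs: "cmod b < 1" if "b \<in> set bs" for b
  proof -
    have "poly ?\<chi> b = 0"
      unfolding \<chi> using that by (auto simp: ls_def poly_prod_list o_def prod_list_zero_iff)
    moreover have "b \<noteq> 1"
    proof
      assume "b = 1"
      then have "poly (\<Prod>a\<leftarrow>bs. [:- a, 1:]) 1 = 0"
        using that by (auto simp: poly_prod_list o_def prod_list_zero_iff)
      \<comment> \<open>The derivative of \<open>(z - 1) * q\<close> at 1 is the value of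
        \<open>q\<close> there.\<close>
      then have "poly (pderiv ?\<chi>) 1 = 0"
        unfolding \<chi> ls_def by (simp add: pderiv_mult pderiv_pCons pderiv_diff)
      with simple show False by simp
    qed
    ultimately show ?thesis using others by blast
  qed
  \<comment> \<open>Lists are indexed from 0, the eigenvalues from 1.\<close>
  define l where "l j = ls ! (j - 1)" for j
  have "(\<Prod>j=1..n. [:- l j, 1:]) = (\<Prod>i<n. [:- (ls ! i), 1:])"
    by (rule prod.reindex_bij_witness[of _ Suc "\<lambda>j. j - 1"]) (auto simp: l_def)
  also have "\<dots> = (\<Prod>a\<leftarrow>ls. [:- a, 1:])"
    using len by (simp add: prod.list_conv_set_nth lessThan_atLeast0)
  finally have "?\<chi> = (\<Prod>j=1..n. [:- l j, 1:])" using \<chi> by simp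
  moreover have "l 1 = 1" by (simp add: l_def ls_def)
  moreover have "cmod (l 2) < 1"
    using bs[of "bs ! 0"] nth_mem[of 0 bs] len \<open>2 \<le> n\<close> by (auto simp: l_def ls_def Suc_le_eq)
  moreover have "cmod (l (Suc j)) \<le> cmod (l j)" if "j \<in> {2..<n}" for j
  proof -
    have "sorted (map (\<lambda>z. - cmod z) bs)" by (simp add: bs_def)
    then have "- cmod (bs ! (j - 2)) \<le> - cmod (bs ! (j - 1))"
      using that len sorted_nth_mono[of "map (\<lambda>z. - cmod z) bs" "j - 2" "j - 1"] by (auto simp: ls_def)
    moreover have "l j = bs ! (j - 2)" "l (Suc j) = bs ! (j - 1)"
      using that by (auto simp: l_def ls_def nth_Cons' numeral_2_eq_2)
    ultimately show ?thesis by simp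
  qed
  ultimately show ?thesis unfolding ordered_eigenvalues_def by blast
qed

lemma ordered_eigenvalues_le:
  assumes "ordered_eigenvalues n G l" "2 \<le> j" "j \<le> n"
  shows "cmod (l j) \<le> cmod (l 2)"
  using assms(2,3)
proof (induction j rule: dec_induct)
  case (step j)
  then show ?case using assms(1) unfolding ordered_eigenvalues_def by force
qed simp

lemma ordered_eigenvalues_eigenvalue:
  assumes l: "ordered_eigenvalues n G l" and G: "G \<in> carrier_mat n n"
    and "eigenvalue (complex_mat G) \<mu>" "\<mu> \<noteq> 1"
  obtains j where "2 \<le> j" "j \<le> n" "\<mu> = l j"
proof -
  have "poly (char_poly (complex_mat G)) \<mu> = 0"
    using assms(3) eigenvalue_root_char_poly[of "complex_mat G" n] G by simp
  then have "(\<Prod>j=1..n. \<mu> - l j) = 0" using l by (simp add: ordered_eigenvalues_def poly_prod)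
  then obtain j where j: "j \<in> {1..n}" "\<mu> = l j" by auto
  with l \<open>\<mu> \<noteq> 1\<close> have "j \<noteq> 1" by (auto simp: ordered_eigenvalues_def)
  with j show ?thesis by (intro that[of j]) auto
qed

section \<open>The minimal nonnegative solution\<close>

lemma mat_tendsto_mult:
  assumes "mat_tendsto n A A'" "mat_tendsto n B B'"
  shows "mat_tendsto n (\<lambda>k. A k * B k) (A' * B')"
proof -
  have c: "A' \<in> carrier_mat n n" "B' \<in> carrier_mat n n" "A k \<in> carrier_mat n n" "B k \<in> carrier_mat n n" for k
    using assms by (auto simp: mat_tendsto_def)
  have "(\<lambda>k. (A k * B k) $$ (i, j)) \<longlonglongrightarrow> (A' * B') $$ (i, j)" if "i < n" "j < n" for i j
    unfolding index_mult_mat_sum[OF c(1,2) that] index_mult_mat_sum[OF c(3,4) that]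
    using assms that by (intro tendsto_intros) (auto simp: mat_tendsto_def)
  then show ?thesis using c mult_carrier_mat[OF c(1,2)] mult_carrier_mat[OF c(3,4)]
    by (simp add: mat_tendsto_def del: index_mult_mat)
qed

lemma mat_tendsto_mult_vec:
  assumes "mat_tendsto n A A'" "x \<in> carrier_vec n" "i < n"
  shows "(\<lambda>k. (A k *\<^sub>v x) $ i) \<longlonglongrightarrow> (A' *\<^sub>v x) $ i"
proof -
  have c: "A' \<in> carrier_mat n n" "A k \<in> carrier_mat n n" for k
    using assms by (auto simp: mat_tendsto_def)
  show ?thesis
    unfolding index_mult_mat_vec_sum[OF c(1) assms(2,3)] index_mult_mat_vec_sum[OF c(2) assms(2,3)]
    using assms by (intro tendsto_intros) (auto simp: mat_tendsto_def)
qed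

lemma mat_tendsto_unique:
  assumes "mat_tendsto n A B" "mat_tendsto n A C"
  shows "B = C"
proof (rule eq_matI)
  fix i j assume "i < dim_row C" "j < dim_col C"
  then show "B $$ (i, j) = C $$ (i, j)"
    using assms by (intro LIMSEQ_unique[of "\<lambda>k. A k $$ (i, j)"]) (auto simp: mat_tendsto_def)
qed (use assms in \<open>auto simp: mat_tendsto_def\<close>)

lemma mat_tendsto_two_minus:
  assumes "mat_tendsto n A B"
  shows "mat_tendsto n (\<lambda>k. two_minus n (A k)) (two_minus n B)"
proof -
  have c: "B \<in> carrier_mat n n" "A k \<in> carrier_mat n n" for k
    using assms by (auto simp: mat_tendsto_def)
  have "(\<lambda>k. two_minus n (A k) $$ (i, j)) \<longlonglongrightarrow> two_minus n B $$ (i, j)" if "i < n" "j < n" for i j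
  proof -
    have e: "two_minus n M $$ (i, j) = 2 * (1\<^sub>m n) $$ (i, j) - M $$ (i, j)" if "M \<in> carrier_mat n n" for M
      using that \<open>i < n\<close> \<open>j < n\<close> by simp
    show ?thesis unfolding e[OF c(1)] e[OF c(2)]
      using assms that by (intro tendsto_intros) (auto simp: mat_tendsto_def)
  qed
  then show ?thesis using c by (simp add: mat_tendsto_def minus_carrier_mat)
qed

lemma mat_tendsto_eventually_norm_bound:
  assumes "mat_tendsto n A B" "0 < e"
  shows "\<forall>\<^sub>F k in sequentially. norm_bound (A k - B) e"
proof -
  have "\<forall>\<^sub>F k in sequentially. \<bar>A k $$ (i, j) - B $$ (i, j)\<bar> < e" if "i < n" "j < n" for i j
    using assms that tendstoD[of "\<lambda>k. A k $$ (i, j)" "B $$ (i, j)" sequentially e]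
    by (simp add: mat_tendsto_def dist_real_def)
  then have "\<forall>\<^sub>F k in sequentially. \<forall>i\<in>{..<n}. \<forall>j\<in>{..<n}. \<bar>A k $$ (i, j) - B $$ (i, j)\<bar> < e"
    by (intro eventually_ball_finite ballI) auto
  then show ?thesis
    using assms(1) by (elim eventually_mono) (auto simp: norm_bound_def mat_tendsto_def less_imp_le)
qed

text \<open>After a left factor that kills \<open>u\<close>, the matrix \<open>G\<close> may be
  replaced by its deflation, since \<open>M (u w^T) = (M u) w^T = 0\<close>.\<close>

lemma mult_deflate:
  fixes M G :: "real mat"
  assumes M: "M \<in> carrier_mat n n" and G: "G \<in> carrier_mat n n" and u: "u \<in> carrier_vec n"
    and Mu: "M *\<^sub>v u = 0\<^sub>v n"
  shows "M * deflate n G u w = M * G"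
proof -
  let ?R = "mat n n (\<lambda>(i, j). u $ i * w $ j)"
  have "(M * ?R) $$ (i, j) = 0" if "i < n" "j < n" for i j
  proof -
    have "(M * ?R) $$ (i, j) = (\<Sum>k<n. M $$ (i, k) * u $ k) * w $ j"
      using that M by (simp add: index_mult_mat_sum[of _ n n _ n] sum_distrib_right mult.assoc del: index_mult_mat)
    also have "(\<Sum>k<n. M $$ (i, k) * u $ k) = 0"
      using Mu that index_mult_mat_vec_sum[OF M u, of i] by simp
    finally show ?thesis by simp
  qed
  then have "M * ?R = 0\<^sub>m n n" using M by (intro eq_matI) (auto simp del: index_mult_mat(1))
  then show ?thesis
    unfolding deflate_def using M G mult_minus_distrib_mat[OF M G, of ?R]
    by (simp del: index_mult_mat) (auto intro!: eq_matI simp del: index_mult_mat(1))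
qed

text \<open>The mirror image of \<open>mult_deflate\<close>: here \<open>w^T M = 0\<close>, stated
  column by column, and the left factor is deflated.\<close>

lemma deflate_mult:
  fixes M H :: "real mat"
  assumes M: "M \<in> carrier_mat n n" and H: "H \<in> carrier_mat n n" and u: "u \<in> carrier_vec n"
    and w: "w \<in> carrier_vec n" and wM: "\<And>j. j < n \<Longrightarrow> w \<bullet> col M j = 0"
  shows "deflate n H u w * M = H * M"
proof (rule mat_col_eqI)
  fix j assume "j < dim_col (H * M)"
  then have j: "j < n" using M by simp
  have "col (deflate n H u w * M) j = deflate n H u w *\<^sub>v col M j"
    using M j by (intro col_mult2[of _ n n _ n]) auto
  also have "\<dots> = H *\<^sub>v col M j"
    using M H u w j wM[OF j] by (subst deflate_mult_vec) (auto simp: vec_eq_iff)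
  also have "\<dots> = col (H * M) j" by (rule col_mult2[OF H M j, symmetric])
  finally show "col (deflate n H u w * M) j = col (H * M) j" .
qed (use M H in \<open>auto simp: deflate_def\<close>)

lemma complex_deflate:
  assumes "M \<in> carrier_mat n n" "u \<in> carrier_vec n" "w \<in> carrier_vec n"
  shows "complex_mat (deflate n M u w) =
    deflate n (complex_mat M) (map_vec complex_of_real u) (map_vec complex_of_real w)"
  using assms by (intro eq_matI) (auto simp: deflate_def)

lemma complex_mult_vec_real:
  assumes "M \<in> carrier_mat n n" "x \<in> carrier_vec n"
  shows "complex_mat M *\<^sub>v map_vec complex_of_real x = map_vec complex_of_real (M *\<^sub>v x)"
  by (rule of_real_hom.mult_mat_vec_hom[OF assms, symmetric])

context positive_weight
begin

text \<open>A single term of the weighted row sum gives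
  \<open>X $$ (i, j) \<le> u $ i / u $ j\<close>, a bound uniform over the whole class.\<close>

lemma substochastic_norm_bound:
  "\<exists>K\<ge>0. \<forall>X. substochastic n u X \<longrightarrow> norm_bound X K"
proof -
  define R where "R = mat n n (\<lambda>(i, j). u $ i / u $ j)"
  define K where "K = Max {norm (R $$ (i,j)) | i j. i < dim_row R \<and> j < dim_col R}"
  have K: "norm_bound R K" unfolding K_def by (rule norm_bound_max)
  have "norm (R $$ (0, 0)) \<le> K"
    using K[unfolded norm_bound_def, rule_format, of 0 0] n_pos by (simp add: R_def)
  then have "0 \<le> K" by (meson norm_ge_zero order_trans)
  moreover have "norm_bound X K" if X: "substochastic n u X" for X
  proof
    fix i j assume "i < dim_row X" "j < dim_col X"
    then have ij: "i < n" "j < n" using substochasticD(1)[OF X] by auto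
    have "X $$ (i, j) * u $ j \<le> (\<Sum>j<n. X $$ (i, j) * u $ j)"
      using ij substochasticD(2)[OF X] u_pos by (intro member_le_sum) (auto simp: less_imp_le)
    then have "X $$ (i, j) \<le> u $ i / u $ j"
      using substochasticD(3)[OF X ij(1)] u_pos[OF ij(2)] by (simp add: field_simps)
    also have "\<dots> \<le> K" using K[unfolded norm_bound_def, rule_format, of i j] ij
        u_pos[OF ij(1)] u_pos[OF ij(2)]
      by (simp add: R_def)
    finally show "norm (X $$ (i, j)) \<le> K" using substochasticD(2)[OF X ij] by simp
  qed
  ultimately show ?thesis by blast
qed

lemma substochastic_resolvent: "substochastic n u X \<Longrightarrow> substochastic n u (resolvent n X)"
  using resolvent resolvent_u_le by (simp add: substochastic_def)

lemma substochastic_one: "substochastic n u (1\<^sub>m n)"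
  by (simp add: substochastic_def less_eq_mat_def)

lemma substochastic_mult:
  assumes X: "substochastic n u X" and Y: "substochastic n u Y"
  shows "substochastic n u (X * Y)"
proof -
  note X' = substochasticD(1,4,5)[OF X] and Y' = substochasticD(1,4,5)[OF Y]
  have "X *\<^sub>v (Y *\<^sub>v u) \<le> X *\<^sub>v u"
    using nonneg_mat_mult_vec_mono[OF X'(1,2) _ Y'(3)] Y'(1) by simp
  then have "(X * Y) *\<^sub>v u \<le> u" using X' Y' by (simp add: order_trans[OF _ X'(3)])
  then show ?thesis unfolding substochastic_def
    using mult_carrier_mat[OF X'(1) Y'(1)] nonneg_mat_mult[OF X'(1) Y'(1) X'(2) Y'(2)] by simp
qed

end

section \<open>The matrix \<open>G\<close> as a limit, and its spectrum\<close>

locale quadratic_equation = positive_weight +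
  fixes N :: "real mat"
  assumes N_carrier: "N \<in> carrier_mat n n" and N_nonneg: "0\<^sub>m n n \<le> N"
    and N_u: "N *\<^sub>v u = u" and N_simple: "simple_eigenvalue N 1"
begin

abbreviation "cu \<equiv> map_vec complex_of_real u"

lemma u_nonzero: "u \<noteq> 0\<^sub>v n"
  using u_pos[OF n_pos] n_pos by auto

lemma cu_nonzero: "cu \<noteq> 0\<^sub>v n"
proof
  assume "cu = 0\<^sub>v n"
  then have "cu $ 0 = 0" using n_pos by simp
  then show False using u_pos[OF n_pos] n_pos carrier_vecD[OF u_carrier] by simp
qed

lemma N_substochastic: "substochastic n u N"
  using N_carrier N_nonneg N_u by (simp add: substochastic_def)

lemma N_fixed:
  assumes "x \<in> carrier_vec n" "N *\<^sub>v x = x"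
  shows "\<exists>c. x = c \<cdot>\<^sub>v u"
proof (rule simple_root_eigenspace[OF N_carrier, of 1])
  show "poly (pderiv (char_poly N)) 1 \<noteq> 0"
    using N_simple degree_monic_char_poly[OF N_carrier]
    by (intro poly_pderiv_simple_root) (auto simp: simple_eigenvalue_def)
qed (use assms N_u u_nonzero in auto)

lemma complex_N_fixed:
  assumes "x \<in> carrier_vec n" "complex_mat N *\<^sub>v x = x"
  shows "\<exists>c. x = c \<cdot>\<^sub>v cu"
proof (rule simple_root_eigenspace[of "complex_mat N" n 1])
  show "poly (pderiv (char_poly (complex_mat N))) 1 \<noteq> 0"
    using simple_eigenvalue_complex[OF N_carrier N_simple] by simp
qed (use assms N_u cu_nonzero N_carrier in \<open>auto simp: complex_mult_vec_real[OF N_carrier]\<close>)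

primrec zero_iterate :: "nat \<Rightarrow> real mat" where
  "zero_iterate 0 = 0\<^sub>m n n"
| "zero_iterate (Suc k) = resolvent n (zero_iterate k) * N"

lemma zero_iterate_substochastic: "substochastic n u (zero_iterate k)"
proof (induction k)
  case 0
  have "0\<^sub>m n n *\<^sub>v u = 0\<^sub>v n" by (intro eq_vecI) auto
  then show ?case using u_pos u_carrier
    by (auto simp: substochastic_def less_eq_mat_def less_eq_vec_def less_imp_le)
qed (use substochastic_step N_carrier N_nonneg N_u in auto)

lemmas zero_iterate_carrier = substochasticD(1)[OF zero_iterate_substochastic]

lemma zero_iterate_eq: "two_minus n (zero_iterate k) * zero_iterate (Suc k) = N"
  using two_minus_resolvent_mult[OF zero_iterate_substochastic N_carrier] by simp

lemma zero_iterate_mono: "zero_iterate k \<le> zero_iterate (Suc k)"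
proof (induction k)
  case 0
  show ?case using substochasticD(4)[OF zero_iterate_substochastic[of "Suc 0"]] by simp
next
  case (Suc k)
  show ?case
    by (rule step_mono[OF zero_iterate_substochastic[of k] zero_iterate_carrier[of "Suc k"]
        zero_iterate_carrier[of "Suc (Suc k)"] zero_iterate_carrier[of "Suc k"] _ Suc
        substochasticD(4)[OF zero_iterate_substochastic]])
      (simp only: zero_iterate_eq)
qed

text \<open>A solution is its own successor in the iteration, so \<open>step_mono\<close> applies.
  That comparison asks for the weighted bound on the lower matrix, hence \<open>Y\<close> may be any
  nonnegative solution.\<close>

lemma zero_iterate_le_solution:
  assumes "solution n N Y" "0\<^sub>m n n \<le> Y"
  shows "zero_iterate k \<le> Y"
proof (induction k)
  case 0
  show ?case using assms by simp
next
  case (Suc k)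
  have Y: "Y \<in> carrier_mat n n" "two_minus n Y * Y = N"
    using assms solution_iff[OF N_carrier] by auto
  show ?case
    by (rule step_mono[OF zero_iterate_substochastic[of k] Y(1) Y(1) zero_iterate_carrier _ Suc assms(2)])
      (simp only: zero_iterate_eq Y)
qed

text \<open>\<open>lim\<close> has its intended value because the entries increase and are bounded,
  as \<open>zero_iterate_tendsto\<close> shows.\<close>

definition G :: "real mat" where
  "G = mat n n (\<lambda>(i, j). lim (\<lambda>k. zero_iterate k $$ (i, j)))"

lemma G_carrier [simp]: "G \<in> carrier_mat n n"
  by (simp add: G_def)

lemma G_dim [simp]: "dim_row G = n" "dim_col G = n"
  by (simp_all add: G_def)

lemma G_mult_vec_carrier [simp]:
  "x \<in> carrier_vec n \<Longrightarrow> G *\<^sub>v x \<in> carrier_vec n"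
  "y \<in> carrier_vec n \<Longrightarrow> complex_mat G *\<^sub>v y \<in> carrier_vec n"
  by (auto intro!: mult_mat_vec_carrier[of _ n n])

lemma zero_iterate_tendsto: "mat_tendsto n zero_iterate G"
proof -
  obtain K where K: "\<And>X. substochastic n u X \<Longrightarrow> norm_bound X K"
    using substochastic_norm_bound by blast
  have "convergent (\<lambda>k. zero_iterate k $$ (i, j))" if ij: "i < n" "j < n" for i j
  proof (rule Bseq_monoseq_convergent)
    show "Bseq (\<lambda>k. zero_iterate k $$ (i, j))"
      using K[OF zero_iterate_substochastic] carrier_matD[OF zero_iterate_carrier] ij
      by (intro BseqI'[of _ K]) (auto simp: norm_bound_def simp del: zero_iterate.simps)
    show "monoseq (\<lambda>k. zero_iterate k $$ (i, j))"
      using zero_iterate_mono carrier_matD[OF zero_iterate_carrier] ij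
      by (intro mono_SucI1) (auto simp: monoseq_Suc less_eq_mat_def simp del: zero_iterate.simps)
  qed
  then show ?thesis using zero_iterate_carrier
    by (auto simp: mat_tendsto_def G_def convergent_LIMSEQ_iff)
qed

lemma G_substochastic: "substochastic n u G"
  unfolding substochastic_def
proof (intro conjI)
  note lim = zero_iterate_tendsto[unfolded mat_tendsto_def]
  have "0 \<le> G $$ (i, j)" if "i < n" "j < n" for i j
    using lim that substochasticD(2)[OF zero_iterate_substochastic] by (intro LIMSEQ_le_const[of "\<lambda>k. zero_iterate k $$ (i, j)"]) auto
  then show "0\<^sub>m n n \<le> G" by (simp add: nonneg_mat_iff)
  have "(G *\<^sub>v u) $ i \<le> u $ i" if "i < n" for i
    using mat_tendsto_mult_vec[OF zero_iterate_tendsto u_carrier that]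
      substochasticD(5)[OF zero_iterate_substochastic] that carrier_vecD[OF u_carrier]
    by (intro LIMSEQ_le_const2[of "\<lambda>k. (zero_iterate k *\<^sub>v u) $ i"])
      (auto simp: less_eq_vec_def simp del: index_mult_mat_vec)
  then show "G *\<^sub>v u \<le> u" using carrier_vecD[OF u_carrier] carrier_matD[OF G_carrier]
    by (auto simp: less_eq_vec_def simp del: index_mult_mat_vec)
qed simp

lemma G_eq: "two_minus n G * G = N"
proof (rule mat_tendsto_unique)
  have "mat_tendsto n (\<lambda>k. two_minus n (zero_iterate k)) (two_minus n G)"
    by (rule mat_tendsto_two_minus[OF zero_iterate_tendsto])
  moreover have "mat_tendsto n (\<lambda>k. zero_iterate (Suc k)) G"
    using zero_iterate_tendsto unfolding mat_tendsto_def by (auto intro: LIMSEQ_Suc simp del: zero_iterate.simps)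
  ultimately have "mat_tendsto n (\<lambda>k. two_minus n (zero_iterate k) * zero_iterate (Suc k)) (two_minus n G * G)"
    by (rule mat_tendsto_mult)
  then show "mat_tendsto n (\<lambda>k. N) (two_minus n G * G)" by (simp only: zero_iterate_eq)
  show "mat_tendsto n (\<lambda>k. N) N" using N_carrier by (simp add: mat_tendsto_def)
qed

lemma G_minimal: "minimal_nonneg_solution n N G"
  unfolding minimal_nonneg_solution_def
proof (intro conjI allI impI)
  show "solution n N G" using G_eq solution_iff[OF N_carrier] by simp
  show "0\<^sub>m n n \<le> G" using G_substochastic by (simp add: substochastic_def)
  fix Y assume Y: "solution n N Y \<and> 0\<^sub>m n n \<le> Y"
  then have Yc: "Y \<in> carrier_mat n n" by (simp add: solution_def)
  have le: "zero_iterate k $$ (i, j) \<le> Y $$ (i, j)" if "i < n" "j < n" for i j k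
    using zero_iterate_le_solution[of Y k] Y Yc that by (auto simp: less_eq_mat_def)
  have "G $$ (i, j) \<le> Y $$ (i, j)" if "i < n" "j < n" for i j
    using zero_iterate_tendsto le that unfolding mat_tendsto_def
    by (intro LIMSEQ_le_const2[of "\<lambda>k. zero_iterate k $$ (i, j)"]) auto
  then show "G \<le> Y" using Yc carrier_matD[OF G_carrier] by (auto simp: less_eq_mat_def)
qed

lemma N_mult_vec:
  assumes "x \<in> carrier_vec n"
  shows "N *\<^sub>v x = 2 \<cdot>\<^sub>v (G *\<^sub>v x) - G *\<^sub>v (G *\<^sub>v x)"
proof -
  have "two_minus n G \<in> carrier_mat n n" by (simp add: minus_carrier_mat)
  from assoc_mult_mat_vec[OF this G_carrier assms] G_eq
  have "N *\<^sub>v x = two_minus n G *\<^sub>v (G *\<^sub>v x)" by simp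
  then show ?thesis using assms by (simp add: two_minus_mult_vec)
qed

lemma complex_N_eq: "complex_mat N = 2 \<cdot>\<^sub>m complex_mat G - complex_mat G * complex_mat G"
proof -
  have "N = 2 \<cdot>\<^sub>m G - G * G" using G_eq two_minus_mult[OF G_carrier G_carrier] by simp
  moreover have "complex_mat (2 \<cdot>\<^sub>m G - G * G) = 2 \<cdot>\<^sub>m complex_mat G - complex_mat (G * G)"
    by (intro eq_matI) auto
  ultimately show ?thesis by (simp only: of_real_hom.mat_hom_mult[OF G_carrier G_carrier])
qed

lemma complex_N_mult_vec:
  assumes "x \<in> carrier_vec n"
  shows "complex_mat N *\<^sub>v x = 2 \<cdot>\<^sub>v (complex_mat G *\<^sub>v x) - complex_mat G *\<^sub>v (complex_mat G *\<^sub>v x)"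
proof -
  define M where "M = complex_mat G"
  have M: "M \<in> carrier_mat n n" by (simp add: M_def)
  have "(2 \<cdot>\<^sub>m M - M * M) *\<^sub>v x = (2 \<cdot>\<^sub>m M) *\<^sub>v x - (M * M) *\<^sub>v x"
    using M assms by (intro minus_mult_distrib_mat_vec) auto
  also have "(2 \<cdot>\<^sub>m M) *\<^sub>v x = 2 \<cdot>\<^sub>v (M *\<^sub>v x)" using M assms by (intro eq_vecI) auto
  finally show ?thesis unfolding complex_N_eq M_def[symmetric] using M assms by simp
qed

text \<open>The defect \<open>w = u - G u\<close> satisfies \<open>(I - G) w = (I - N) u = 0\<close>, hence \<open>N w = w\<close>, so \<open>w\<close> is a
  multiple of \<open>u\<close> and \<open>(I - G) u\<close> vanishes.\<close>
lemma G_u: "G *\<^sub>v u = u"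
proof -
  define w where "w = u - G *\<^sub>v u"
  have w: "w \<in> carrier_vec n" by (simp add: w_def)
  have Gu: "G *\<^sub>v u \<in> carrier_vec n" by simp
  have eq: "u = 2 \<cdot>\<^sub>v (G *\<^sub>v u) - G *\<^sub>v (G *\<^sub>v u)" using N_mult_vec[of u] N_u by simp
  have Gw: "G *\<^sub>v w = w"
  proof -
    have "G *\<^sub>v w = G *\<^sub>v u - G *\<^sub>v (G *\<^sub>v u)"
      unfolding w_def by (rule mult_minus_distrib_mat_vec) auto
    also have "\<dots> = u - G *\<^sub>v u"
    proof (rule eq_vecI)
      fix i assume "i < dim_vec (u - G *\<^sub>v u)"
      then have i: "i < n" using carrier_vecD[OF Gu] by simp
      show "(G *\<^sub>v u - G *\<^sub>v (G *\<^sub>v u)) $ i = (u - G *\<^sub>v u) $ i"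
        using arg_cong[OF eq, of "\<lambda>v. v $ i"] i carrier_vecD[OF u_carrier] carrier_matD[OF G_carrier]
        by (simp del: index_mult_mat_vec)
    qed (use Gu in auto)
    finally show ?thesis by (simp add: w_def)
  qed
  have "N *\<^sub>v w = w" using w N_mult_vec[OF w] Gw by (auto simp: vec_eq_iff)
  then obtain c where c: "w = c \<cdot>\<^sub>v u" using N_fixed w by blast
  have "w = 0\<^sub>v n"
  proof (cases "c = 0")
    case True
    then show ?thesis using c u_carrier by auto
  next
    case False
    have "c \<cdot>\<^sub>v (G *\<^sub>v u) = c \<cdot>\<^sub>v u" using Gw c mult_mat_vec[OF G_carrier u_carrier] by simp
    then have "G *\<^sub>v u = u" using False Gu u_carrier
      by (metis (no_types, lifting) one_smult_vec smult_smult_assoc left_inverse)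
    then show ?thesis using u_carrier by (simp add: w_def)
  qed
  then show ?thesis using u_carrier Gu unfolding w_def
    by (metis (no_types, lifting) carrier_vecD eq_vecI index_minus_vec(1) index_zero_vec(1) right_minus_eq)
qed

text \<open>The hypothesis reads \<open>(I - G)^2 x = 0\<close>, and
  \<open>(I - G)^2 = I - N\<close>, so the simplicity for \<open>N\<close> applies.\<close>

lemma complex_G_kernel:
  assumes x: "x \<in> carrier_vec n"
    and eq: "complex_mat G *\<^sub>v (complex_mat G *\<^sub>v x - x) = complex_mat G *\<^sub>v x - x"
  shows "\<exists>c. x = c \<cdot>\<^sub>v cu"
proof (rule complex_N_fixed[OF x])
  define y where "y = complex_mat G *\<^sub>v x"
  have y: "y \<in> carrier_vec n" and Gy: "complex_mat G *\<^sub>v y \<in> carrier_vec n"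
    using x by (auto simp: y_def intro!: mult_mat_vec_carrier[of _ n n])
  have "complex_mat G *\<^sub>v (y - x) = complex_mat G *\<^sub>v y - y"
    unfolding y_def using x by (intro mult_minus_distrib_mat_vec) (auto intro!: mult_mat_vec_carrier[of _ n n])
  with eq have e: "complex_mat G *\<^sub>v y - y = y - x" by (simp add: y_def)
  show "complex_mat N *\<^sub>v x = x"
    unfolding complex_N_mult_vec[OF x] y_def[symmetric]
  proof (rule eq_vecI)
    fix i assume "i < dim_vec x"
    then show "(2 \<cdot>\<^sub>v y - complex_mat G *\<^sub>v y) $ i = x $ i"
      using arg_cong[OF e, of "\<lambda>v. v $ i"] x y carrier_matD[OF G_carrier]
      by (simp add: algebra_simps del: index_mult_mat_vec)
  qed (use x y in simp)
qed

text \<open>On the unit circle \<open>\<mu>\<close> would yield the eigenvalue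
  \<open>\<mu> * (2 - \<mu>)\<close> of \<open>N\<close>, so
  \<open>cmod (2 - \<mu>) \<le> 1\<close>. The closed unit discs about 0 and 2 meet only at
  1.\<close>

lemma complex_G_eigenvalue_less_1:
  assumes ev: "eigenvalue (complex_mat G) \<mu>" and "\<mu> \<noteq> 1"
  shows "cmod \<mu> < 1"
proof (rule ccontr)
  assume "\<not> cmod \<mu> < 1"
  with substochastic_eigenvalue_le_1[OF G_substochastic ev] have 1: "cmod \<mu> = 1" by simp
  obtain x where x: "x \<in> carrier_vec n" "x \<noteq> 0\<^sub>v n" "complex_mat G *\<^sub>v x = \<mu> \<cdot>\<^sub>v x"
    using ev carrier_matD[OF G_carrier] unfolding eigenvalue_def eigenvector_def by auto
  have "complex_mat N *\<^sub>v x = (\<mu> * (2 - \<mu>)) \<cdot>\<^sub>v x"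
    unfolding complex_N_mult_vec[OF x(1)] x(3)
    using x mult_mat_vec[of "complex_mat G" n n x \<mu>]
    by (intro eq_vecI) (auto simp: algebra_simps)
  then have "eigenvalue (complex_mat N) (\<mu> * (2 - \<mu>))"
    unfolding eigenvalue_def eigenvector_def using x N_carrier by auto
  from substochastic_eigenvalue_le_1[OF N_substochastic this]
  have "cmod (2 - \<mu>) \<le> 1" using 1 by (simp add: norm_mult)
  then have "Re (2 - \<mu>) \<le> 1" using complex_Re_le_cmod order_trans by blast
  then have "1 \<le> Re \<mu>" by simp
  moreover have "(Re \<mu>)\<^sup>2 + (Im \<mu>)\<^sup>2 = 1" using 1 by (simp add: cmod_power2[symmetric])
  ultimately have "Re \<mu> = 1 \<and> Im \<mu> = 0"
    by (smt (verit) one_le_power power2_eq_1_iff power2_eq_iff_nonneg zero_le_power2 zero_eq_power2)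
  with \<open>\<mu> \<noteq> 1\<close> show False by (simp add: complex_eq_iff)
qed

lemma ordered_eigenvalues_G:
  assumes "2 \<le> n"
  shows "\<exists>l. ordered_eigenvalues n G l"
proof (rule ordered_eigenvalues_exist[OF G_carrier assms])
  have cG: "complex_mat G \<in> carrier_mat n n" by simp
  have "complex_mat G *\<^sub>v cu = cu" using complex_mult_vec_real[OF G_carrier u_carrier] G_u by simp
  then have "eigenvalue (complex_mat G) 1"
    unfolding eigenvalue_def eigenvector_def using cu_nonzero carrier_matD[OF G_carrier]
    by (intro exI[of _ cu]) auto
  then show root: "poly (char_poly (complex_mat G)) 1 = 0"
    using eigenvalue_root_char_poly[OF cG] by simp
  show "poly (pderiv (char_poly (complex_mat G))) 1 \<noteq> 0"
    using simple_root_quadratic[OF cG root] simple_eigenvalue_complex[OF N_carrier N_simple]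
    by (simp add: complex_N_eq)
  show "cmod \<mu> < 1" if "poly (char_poly (complex_mat G)) \<mu> = 0" "\<mu> \<noteq> 1" for \<mu>
    using that complex_G_eigenvalue_less_1 eigenvalue_root_char_poly[OF cG] by simp
qed

text \<open>A nonzero eigenvalue of the deflated matrix is an eigenvalue of \<open>G\<close> other
  than 1, hence some \<open>l j\<close> with \<open>2 \<le> j\<close>.\<close>

lemma deflate_G_eigenvalue:
  assumes l: "ordered_eigenvalues n G l" and w: "w \<in> carrier_vec n" "w \<bullet> u = 1"
    and ev: "eigenvalue (complex_mat (deflate n G u w)) \<mu>"
  shows "cmod \<mu> \<le> cmod (l 2)"
proof (cases "\<mu> = 0")
  case False
  have cw: "map_vec complex_of_real w \<bullet> cu = 1"
    using w by (simp add: scalar_prod_def flip: of_real_mult of_real_sum)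
  have "\<mu> \<noteq> 1" "eigenvalue (complex_mat G) \<mu>"
    using deflate_eigenvalue[OF _ _ _ _ cw, of "complex_mat G" n \<mu>] complex_G_kernel ev False w
      complex_mult_vec_real[OF G_carrier u_carrier] G_u complex_deflate[OF G_carrier u_carrier w(1)]
    by auto
  then show ?thesis
    using ordered_eigenvalues_eigenvalue[OF l G_carrier] ordered_eigenvalues_le[OF l] by metis
qed simp

end

text \<open>It splits a rate above a product into separate rates for the two factors of the
  error.\<close>

lemma nearby_product_less:
  fixes a b r :: real
  assumes "0 \<le> a" "0 \<le> b" "a * b < r"
  obtains \<rho> s where "a < \<rho>" "b < s" "\<rho> * s < r"
proof -
  \<comment> \<open>The first bound gives \<open>e * e \<le> e\<close>; the second keeps the total
    increase within half of \<open>r - a * b\<close>.\<close>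
  define e where "e = min 1 ((r - a * b) / (2 * (a + b + 1)))"
  have e: "0 < e" "e \<le> 1" using assms by (auto simp: e_def)
  have "e * (a + b + 1) \<le> (r - a * b) / (2 * (a + b + 1)) * (a + b + 1)"
    unfolding e_def using assms by (intro mult_right_mono) auto
  also have "\<dots> = (r - a * b) / 2" using assms by (simp add: field_simps)
  finally have "e * (a + b + 1) < r - a * b" using assms by simp
  moreover have "(a + e) * (b + e) \<le> a * b + e * (a + b + 1)"
    using e assms mult_left_mono[of e 1 e] by (simp add: algebra_simps)
  ultimately have "(a + e) * (b + e) < r" by simp
  with e show ?thesis by (intro that[of "a + e" "b + e"]) auto
qed

text \<open>From \<open>v^T (2I - X) = v^T\<close>, multiplication by the inverse on the right gives
  the claim.\<close>

lemma (in positive_weight) left_fixed_resolvent: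
  assumes X: "substochastic n u X" and v: "v \<in> carrier_vec n"
    and vX: "mat_of_row v * X = mat_of_row v"
  shows "mat_of_row v * resolvent n X = mat_of_row v"
proof -
  note Xc = substochasticD(1)[OF X]
  have V: "mat_of_row v \<in> carrier_mat 1 n" using v by simp
  have T: "two_minus n X \<in> carrier_mat n n" using Xc by (rule minus_carrier_mat)
  have "mat_of_row v * two_minus n X = mat_of_row v * (2 \<cdot>\<^sub>m 1\<^sub>m n) - mat_of_row v * X"
    using V Xc by (intro mult_minus_distrib_mat) auto
  also have "mat_of_row v * (2 \<cdot>\<^sub>m 1\<^sub>m n) = 2 \<cdot>\<^sub>m mat_of_row v"
    using mult_smult_distrib[OF V one_carrier_mat, of 2] right_mult_one_mat[OF V] by simp
  also have "2 \<cdot>\<^sub>m mat_of_row v - mat_of_row v * X = mat_of_row v"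
    unfolding vX by (intro eq_matI) auto
  finally have "mat_of_row v * two_minus n X * resolvent n X = mat_of_row v * resolvent n X" by simp
  then show ?thesis
    using assoc_mult_mat[OF V T resolvent(1)[OF X]] resolvent(2)[OF X] right_mult_one_mat[OF V] by simp
qed

section \<open>Spectrum of the deflated resolvent of \<open>G\<close>\<close>

context quadratic_equation
begin

abbreviation H :: "real mat" where
  "H \<equiv> resolvent n G"

lemmas H_carrier = resolvent(1)[OF G_substochastic]

lemma H_u: "H *\<^sub>v u = u"
  by (rule resolvent_fixes_u[OF G_substochastic G_u])

lemma complex_H_inverse:
  assumes x: "x \<in> carrier_vec n"
  shows "2 \<cdot>\<^sub>v (complex_mat H *\<^sub>v x) - complex_mat G *\<^sub>v (complex_mat H *\<^sub>v x) = x"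
    "complex_mat H *\<^sub>v (2 \<cdot>\<^sub>v x - complex_mat G *\<^sub>v x) = x"
proof -
  define T where "T = complex_mat (two_minus n G)"
  have T: "T \<in> carrier_mat n n" by (simp add: T_def minus_carrier_mat)
  have cH: "complex_mat H \<in> carrier_mat n n" using H_carrier by simp
  have T_vec: "T *\<^sub>v y = 2 \<cdot>\<^sub>v y - complex_mat G *\<^sub>v y" if y: "y \<in> carrier_vec n" for y
  proof -
    have "T = 2 \<cdot>\<^sub>m 1\<^sub>m n - complex_mat G" by (intro eq_matI) (auto simp: T_def)
    then have "T *\<^sub>v y = (2 \<cdot>\<^sub>m 1\<^sub>m n) *\<^sub>v y - complex_mat G *\<^sub>v y"
      using y by (simp only:) (intro minus_mult_distrib_mat_vec, auto)
    also have "(2 \<cdot>\<^sub>m 1\<^sub>m n) *\<^sub>v y = 2 \<cdot>\<^sub>v y" using y by (intro eq_vecI) auto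
    finally show ?thesis .
  qed
  have G2: "two_minus n G \<in> carrier_mat n n" by (simp add: minus_carrier_mat)
  have TH: "T * complex_mat H = 1\<^sub>m n"
    unfolding T_def of_real_hom.mat_hom_mult[OF G2 H_carrier, symmetric] resolvent(2)[OF G_substochastic]
    by (intro eq_matI) auto
  have HT: "complex_mat H * T = 1\<^sub>m n"
    unfolding T_def of_real_hom.mat_hom_mult[OF H_carrier G2, symmetric] resolvent(3)[OF G_substochastic]
    by (intro eq_matI) auto
  have Hx: "complex_mat H *\<^sub>v x \<in> carrier_vec n" using cH x by simp
  show "2 \<cdot>\<^sub>v (complex_mat H *\<^sub>v x) - complex_mat G *\<^sub>v (complex_mat H *\<^sub>v x) = x"
    using assoc_mult_mat_vec[OF T cH x] T_vec[OF Hx] TH x by simp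
  show "complex_mat H *\<^sub>v (2 \<cdot>\<^sub>v x - complex_mat G *\<^sub>v x) = x"
    using assoc_mult_mat_vec[OF cH T x] T_vec[OF x] HT x by simp
qed

text \<open>The hypothesis makes \<open>d = H x - x\<close> a fixed vector of \<open>H\<close>,
  hence of \<open>G\<close>. Expanding \<open>G d = d\<close> with \<open>(2I - G) H x = x\<close>
  gives \<open>d = G x - x\<close>, which reduces the claim to
  \<open>complex_G_kernel\<close>.\<close>

lemma complex_H_kernel:
  assumes x: "x \<in> carrier_vec n"
    and eq: "complex_mat H *\<^sub>v (complex_mat H *\<^sub>v x - x) = complex_mat H *\<^sub>v x - x"
  shows "\<exists>c. x = c \<cdot>\<^sub>v cu"
proof (rule complex_G_kernel[OF x])
  define d where "d = complex_mat H *\<^sub>v x - x"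
  have cH: "complex_mat H \<in> carrier_mat n n" using H_carrier by simp
  have Hx: "complex_mat H *\<^sub>v x \<in> carrier_vec n" using cH x by simp
  have d: "d \<in> carrier_vec n" using Hx x by (simp add: d_def)
  have "2 \<cdot>\<^sub>v d - complex_mat G *\<^sub>v d = d"
    using complex_H_inverse(1)[OF d] eq by (simp add: d_def)
  note Td = this
  have Gd: "complex_mat G *\<^sub>v d = d"
  proof (rule eq_vecI)
    fix i assume "i < dim_vec d"
    then show "(complex_mat G *\<^sub>v d) $ i = d $ i"
      using arg_cong[OF Td, of "\<lambda>v. v $ i"] d by (simp del: index_mult_mat_vec)
  qed (use d in simp)
  have "complex_mat G *\<^sub>v d = complex_mat G *\<^sub>v (complex_mat H *\<^sub>v x) - complex_mat G *\<^sub>v x"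
    unfolding d_def using Hx x by (intro mult_minus_distrib_mat_vec) auto
  then have "complex_mat G *\<^sub>v x - x = d"
  proof (intro eq_vecI)
    fix i assume e: "complex_mat G *\<^sub>v d = complex_mat G *\<^sub>v (complex_mat H *\<^sub>v x) - complex_mat G *\<^sub>v x"
      and "i < dim_vec d"
    then have i: "i < n" using d by simp
    show "(complex_mat G *\<^sub>v x - x) $ i = d $ i"
      using arg_cong[OF e, of "\<lambda>v. v $ i"] arg_cong[OF complex_H_inverse(1)[OF x], of "\<lambda>v. v $ i"]
        arg_cong[OF Gd, of "\<lambda>v. v $ i"] i x Hx carrier_matD[OF H_carrier]
      by (simp add: d_def del: index_mult_mat_vec) (simp add: algebra_simps)
  qed (use d x in simp)
  with Gd show "complex_mat G *\<^sub>v (complex_mat G *\<^sub>v x - x) = complex_mat G *\<^sub>v x - x" by simp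
qed

text \<open>Put \<open>H x = \<mu> x\<close> into \<open>(2I - G) H x = x\<close> and solve for
  \<open>G x\<close>.\<close>

lemma complex_H_eigenvalue:
  assumes "eigenvalue (complex_mat H) \<mu>"
  shows "\<mu> \<noteq> 0" "eigenvalue (complex_mat G) (2 - 1 / \<mu>)"
proof -
  obtain x where x: "x \<in> carrier_vec n" "x \<noteq> 0\<^sub>v n" "complex_mat H *\<^sub>v x = \<mu> \<cdot>\<^sub>v x"
    using assms carrier_matD[OF H_carrier] unfolding eigenvalue_def eigenvector_def by auto
  have "complex_mat G *\<^sub>v (\<mu> \<cdot>\<^sub>v x) = \<mu> \<cdot>\<^sub>v (complex_mat G *\<^sub>v x)"
    using x by (intro mult_mat_vec[of _ n n]) auto
  with complex_H_inverse(1)[OF x(1)] x(3)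
  have e: "2 \<cdot>\<^sub>v (\<mu> \<cdot>\<^sub>v x) - \<mu> \<cdot>\<^sub>v (complex_mat G *\<^sub>v x) = x" by simp
  show \<mu>: "\<mu> \<noteq> 0"
  proof
    assume "\<mu> = 0"
    then have "x $ i = 0" if "i < n" for i
      using arg_cong[OF e, of "\<lambda>v. v $ i"] that x(1) by (simp del: index_mult_mat_vec)
    then have "x = 0\<^sub>v n" using x(1) by (intro eq_vecI) auto
    with x(2) show False by simp
  qed
  have "complex_mat G *\<^sub>v x = (2 - 1 / \<mu>) \<cdot>\<^sub>v x"
  proof (rule eq_vecI)
    fix i assume "i < dim_vec ((2 - 1 / \<mu>) \<cdot>\<^sub>v x)"
    then show "(complex_mat G *\<^sub>v x) $ i = ((2 - 1 / \<mu>) \<cdot>\<^sub>v x) $ i"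
      using arg_cong[OF e, of "\<lambda>v. v $ i"] \<mu> x(1)
      by (simp del: index_mult_mat_vec) (simp add: field_simps)
  qed (use x in simp)
  then show "eigenvalue (complex_mat G) (2 - 1 / \<mu>)"
    unfolding eigenvalue_def eigenvector_def using x by auto
qed

text \<open>Such an eigenvalue belongs to \<open>H\<close> and differs from 1, so
  \<open>2 - 1 / \<mu>\<close> is an eigenvalue of \<open>G\<close> other than 1, that is, some
  \<open>l j\<close> with \<open>2 \<le> j\<close>.\<close>

lemma deflate_H_eigenvalue:
  assumes l: "ordered_eigenvalues n G l" and w: "w \<in> carrier_vec n" "w \<bullet> u = 1"
    and ev: "eigenvalue (complex_mat (deflate n H u w)) \<mu>" and "\<mu> \<noteq> 0"
  shows "\<exists>j\<in>{2..n}. cmod \<mu> = 1 / cmod (2 - l j)"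
proof -
  have cw: "map_vec complex_of_real w \<bullet> cu = 1"
    using w by (simp add: scalar_prod_def flip: of_real_mult of_real_sum)
  have cH: "complex_mat H \<in> carrier_mat n n" using H_carrier by simp
  have \<mu>: "\<mu> \<noteq> 1" "eigenvalue (complex_mat H) \<mu>"
    using deflate_eigenvalue[OF cH _ _ _ cw, of \<mu>] complex_H_kernel ev \<open>\<mu> \<noteq> 0\<close> w
      complex_mult_vec_real[OF H_carrier u_carrier] H_u complex_deflate[OF H_carrier u_carrier w(1)]
    by auto
  have "2 - 1 / \<mu> \<noteq> 1" using \<mu>(1) \<open>\<mu> \<noteq> 0\<close> by (auto simp: field_simps)
  then obtain j where j: "2 \<le> j" "j \<le> n" "2 - 1 / \<mu> = l j"
    using ordered_eigenvalues_eigenvalue[OF l G_carrier complex_H_eigenvalue(2)[OF \<mu>(2)]] by metis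
  have "2 - l j = 1 / \<mu>" using j(3) by (simp add: algebra_simps)
  then have "cmod \<mu> = 1 / cmod (2 - l j)" by (simp add: norm_divide)
  with j show ?thesis by auto
qed

end

section \<open>Convergence and rates\<close>

locale iteration = quadratic_equation +
  fixes X :: "nat \<Rightarrow> real mat"
  assumes X_0: "substochastic n u (X 0)" and X_Suc: "\<And>k. X (Suc k) = resolvent n (X k) * N"
begin

lemma X_substochastic: "substochastic n u (X k)"
  by (induction k) (simp_all add: X_0 X_Suc substochastic_step N_carrier N_nonneg N_u)

lemmas X_carrier = substochasticD(1)[OF X_substochastic]

lemma X_eq: "two_minus n (X k) * X (Suc k) = N"
  using two_minus_resolvent_mult[OF X_substochastic N_carrier] by (simp add: X_Suc)

lemma zero_iterate_le_X: "zero_iterate k \<le> X k"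
proof (induction k)
  case 0
  show ?case using substochasticD(4)[OF X_0] by simp
next
  case (Suc k)
  show ?case
    by (rule step_mono[OF zero_iterate_substochastic[of k] X_carrier[of k] X_carrier
        zero_iterate_carrier _ Suc substochasticD(4)[OF X_substochastic]])
      (simp only: zero_iterate_eq X_eq)
qed

text \<open>Squeeze: \<open>0 \<le> (X k - Y k) u \<le> u - Y k u\<close> for the iterates \<open>Y k\<close> started at 0, and
  \<open>Y k u\<close> tends to \<open>G u = u\<close>.\<close>
lemma X_tendsto: "mat_tendsto n X G"
proof -
  have "(\<lambda>k. X k $$ (i, j)) \<longlonglongrightarrow> G $$ (i, j)" if ij: "i < n" "j < n" for i j
  proof -
    let ?d = "\<lambda>k. X k $$ (i, j) - zero_iterate k $$ (i, j)"
    let ?b = "\<lambda>k. (u $ i - (zero_iterate k *\<^sub>v u) $ i) / u $ j"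
    have nonneg: "0 \<le> X k $$ (i, m) - zero_iterate k $$ (i, m)" if "m < n" for k m
      using zero_iterate_le_X[of k] ij that X_carrier[of k] by (auto simp: less_eq_mat_def)
    have "?d k \<le> ?b k" for k
    proof -
      have "?d k * u $ j \<le> (\<Sum>m<n. (X k $$ (i, m) - zero_iterate k $$ (i, m)) * u $ m)"
        using ij nonneg u_pos by (intro member_le_sum) (auto simp: less_imp_le)
      also have "\<dots> = (\<Sum>m<n. X k $$ (i, m) * u $ m) - (zero_iterate k *\<^sub>v u) $ i"
        using index_mult_mat_vec_sum[OF zero_iterate_carrier u_carrier ij(1), of k]
        by (simp add: left_diff_distrib sum_subtractf)
      also have "\<dots> \<le> u $ i - (zero_iterate k *\<^sub>v u) $ i"
        using substochasticD(3)[OF X_substochastic ij(1)] by simp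
      finally show ?thesis using u_pos[OF ij(2)] by (simp add: pos_le_divide_eq)
    qed
    moreover have "?b \<longlonglongrightarrow> (u $ i - (G *\<^sub>v u) $ i) / u $ j"
      using u_pos[OF ij(2)] by (intro tendsto_intros mat_tendsto_mult_vec[OF zero_iterate_tendsto u_carrier ij(1)]) auto
    ultimately have "?d \<longlonglongrightarrow> 0"
      using nonneg[OF ij(2)] G_u by (intro tendsto_sandwich[of "\<lambda>_. 0" ?d sequentially ?b 0]) auto
    moreover have "(\<lambda>k. zero_iterate k $$ (i, j)) \<longlonglongrightarrow> G $$ (i, j)"
      using zero_iterate_tendsto ij by (simp add: mat_tendsto_def)
    ultimately show ?thesis using tendsto_add by fastforce
  qed
  then show ?thesis using X_carrier by (simp add: mat_tendsto_def)
qed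

lemma X_u:
  assumes "X 0 *\<^sub>v u = u"
  shows "X k *\<^sub>v u = u"
proof (induction k)
  case (Suc k)
  have "X (Suc k) *\<^sub>v u = resolvent n (X k) *\<^sub>v (N *\<^sub>v u)"
    unfolding X_Suc
    by (rule assoc_mult_mat_vec[OF resolvent(1)[OF X_substochastic] N_carrier u_carrier])
  then show ?case using resolvent_fixes_u[OF X_substochastic Suc] N_u by simp
qed (rule assms)

text \<open>Both \<open>(2I - X k) X (k + 1)\<close> and \<open>(2I - G) G\<close> equal
  \<open>N\<close>; subtracting \<open>(2I - X k) G\<close> from each leaves
  \<open>(2I - X k) (X (k + 1) - G) = (X k - G) G\<close>.\<close>

lemma error_Suc: "X (Suc k) - G = resolvent n (X k) * ((X k - G) * G)"
proof -
  note Xk = X_carrier[of k] and XS = X_carrier[of "Suc k"]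
  have T: "two_minus n (X k) \<in> carrier_mat n n" using Xk by (rule minus_carrier_mat)
  have XG: "X k * G \<in> carrier_mat n n" using Xk by simp
  have "two_minus n (X k) * (X (Suc k) - G) = two_minus n G * G - two_minus n (X k) * G"
    using mult_minus_distrib_mat[OF T XS G_carrier] X_eq G_eq by simp
  also have "\<dots> = (X k - G) * G"
  proof -
    define A B where "A = G * G" and "B = X k * G"
    have "A \<in> carrier_mat n n" "B \<in> carrier_mat n n" using XG by (auto simp: A_def B_def)
    then have "(2 \<cdot>\<^sub>m G - A) - (2 \<cdot>\<^sub>m G - B) = B - A" by (intro eq_matI) auto
    then show ?thesis
      using two_minus_mult[OF G_carrier G_carrier] two_minus_mult[OF Xk G_carrier]
        minus_mult_distrib_mat[OF Xk G_carrier G_carrier] by (simp add: A_def B_def)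
  qed
  finally have "two_minus n (X k) * (X (Suc k) - G) = (X k - G) * G" .
  moreover have "X (Suc k) - G \<in> carrier_mat n n" by (simp add: minus_carrier_mat)
  ultimately show ?thesis
    using resolvent_two_minus_mult[OF X_substochastic[of k]] by metis
qed

text \<open>The product of resolvents is kept apart from the initial error because it stays
  substochastic, which bounds \<open>F\<close> uniformly.\<close>

primrec left_factor :: "nat \<Rightarrow> real mat" where
  "left_factor 0 = 1\<^sub>m n"
| "left_factor (Suc k) = resolvent n (X k) * left_factor k"

lemma left_factor_substochastic: "substochastic n u (left_factor k)"
  by (induction k) (simp_all add: substochastic_one substochastic_mult substochastic_resolvent X_substochastic)

definition F :: "nat \<Rightarrow> real mat" where
  "F k = left_factor k * (X 0 - G)"

lemma F_carrier [simp]: "F k \<in> carrier_mat n n"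
  unfolding F_def
  by (rule mult_carrier_mat[OF substochasticD(1)[OF left_factor_substochastic] minus_carrier_mat[OF G_carrier]])

lemma F_0: "F 0 = X 0 - G"
  using minus_carrier_mat[OF G_carrier, of "X 0"] by (simp add: F_def)

lemma F_Suc: "F (Suc k) = resolvent n (X k) * F k"
  unfolding F_def left_factor.simps
  by (rule assoc_mult_mat[OF resolvent(1)[OF X_substochastic] substochasticD(1)[OF left_factor_substochastic]
        minus_carrier_mat[OF G_carrier]])

lemma error_eq: "X k - G = F k * G ^\<^sub>m k"
proof (induction k)
  case 0
  show ?case using F_carrier[of 0] by (simp add: F_0)
next
  case (Suc k)
  have Gk: "G ^\<^sub>m k \<in> carrier_mat n n" by simp
  note R = resolvent(1)[OF X_substochastic[of k]]
  have FG: "F k * G ^\<^sub>m k \<in> carrier_mat n n" by (rule mult_carrier_mat[OF F_carrier Gk])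
  have "X (Suc k) - G = resolvent n (X k) * (F k * G ^\<^sub>m k * G)"
    unfolding error_Suc Suc ..
  also have "F k * G ^\<^sub>m k * G = F k * G ^\<^sub>m Suc k"
    using assoc_mult_mat[OF F_carrier Gk G_carrier] by simp
  also have "resolvent n (X k) * (F k * G ^\<^sub>m Suc k) = F (Suc k) * G ^\<^sub>m Suc k"
    unfolding F_Suc by (rule assoc_mult_mat[OF R F_carrier pow_carrier_mat[OF G_carrier], symmetric])
  finally show ?case .
qed

lemma F_u:
  assumes "X 0 *\<^sub>v u = u"
  shows "F k *\<^sub>v u = 0\<^sub>v n"
proof (induction k)
  case 0
  have "(X 0 - G) *\<^sub>v u = u - u"
    using minus_mult_distrib_mat_vec[OF X_carrier G_carrier u_carrier] assms G_u by simp
  then show ?case by (simp add: F_0)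
next
  case (Suc k)
  note R = resolvent(1)[OF X_substochastic[of k]]
  have "F (Suc k) *\<^sub>v u = resolvent n (X k) *\<^sub>v 0\<^sub>v n"
    unfolding F_Suc using assoc_mult_mat_vec[OF R F_carrier u_carrier] Suc by simp
  then show ?case using R by (auto intro!: eq_vecI)
qed

lemma error_eq_deflate:
  assumes X0u: "X 0 *\<^sub>v u = u"
  shows "X k - G = F k * deflate n G u w ^\<^sub>m k"
proof -
  let ?Q = "deflate n G u w"
  \<comment> \<open>The induction also records that \<open>M * G ^\<^sub>m m\<close> kills
    \<open>u\<close>, which holds because \<open>G\<close> fixes \<open>u\<close> and is what
    \<open>mult_deflate\<close> asks for.\<close>
  have "M * ?Q ^\<^sub>m m = M * G ^\<^sub>m m \<and> (M * G ^\<^sub>m m) *\<^sub>v u = 0\<^sub>v n"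
    if M: "M \<in> carrier_mat n n" "M *\<^sub>v u = 0\<^sub>v n" for M m
  proof (induction m)
    case 0
    show ?case using M by (simp add: deflate_def)
  next
    case (Suc m)
    have Gm: "G ^\<^sub>m m \<in> carrier_mat n n" and Qm: "?Q ^\<^sub>m m \<in> carrier_mat n n" by simp_all
    have MG: "M * G ^\<^sub>m m \<in> carrier_mat n n" by (rule mult_carrier_mat[OF M(1) Gm])
    have "M * ?Q ^\<^sub>m Suc m = M * ?Q ^\<^sub>m m * ?Q"
      using assoc_mult_mat[OF M(1) Qm deflate_carrier] by simp
    also have "\<dots> = M * G ^\<^sub>m m * G"
      using Suc mult_deflate[OF MG G_carrier u_carrier] by simp
    also have "\<dots> = M * G ^\<^sub>m Suc m"
      using assoc_mult_mat[OF M(1) Gm G_carrier] by simp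
    finally have 1: "M * ?Q ^\<^sub>m Suc m = M * G ^\<^sub>m Suc m" .
    have "(M * G ^\<^sub>m m * G) *\<^sub>v u = 0\<^sub>v n"
      using assoc_mult_mat_vec[OF MG G_carrier u_carrier] G_u Suc by simp
    with 1 show ?case using assoc_mult_mat[OF M(1) Gm G_carrier] by simp
  qed
  from this[OF F_carrier F_u[OF X0u], of k k] show ?thesis using error_eq[of k] by simp
qed

end

lemma norm_bound_exists:
  obtains b where "0 \<le> b" "norm_bound A b"
  using norm_bound_mono[OF norm_bound_max max.cobounded1[of _ 0]] max.cobounded2 by blast

section \<open>Growth of the factors \<open>F k\<close> and the resulting rates\<close>

context iteration
begin

text \<open>With \<open>H k\<close> the resolvent of \<open>X k\<close>, the identity
  \<open>H k - H = H k (X k - G) H\<close> has uniformly bounded outer factors and a middle factor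
  tending to 0.\<close>

lemma resolvent_tendsto:
  assumes "0 < \<delta>"
  shows "\<forall>\<^sub>F k in sequentially. norm_bound (resolvent n (X k) - H) \<delta>"
proof -
  obtain K where K: "0 \<le> K" "\<And>X. substochastic n u X \<Longrightarrow> norm_bound X K"
    using substochastic_norm_bound by blast
  \<comment> \<open>The two products give the entrywise bound \<open>K * (e * K * n) * n\<close>;
    the added 1 keeps the denominator positive.\<close>
  define e where "e = \<delta> / (K * K * n * n + 1)"
  have pos: "0 < K * K * n * n + 1" using K(1) by (simp add: add_nonneg_pos)
  have e: "0 < e" using assms pos by (simp add: e_def)
  have le: "K * (e * K * n) * n \<le> \<delta>"
  proof -
    have "K * (e * K * n) * n \<le> e * (K * K * n * n + 1)" using e by (simp add: algebra_simps)
    also have "\<dots> = \<delta>" using pos by (simp add: e_def)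
    finally show ?thesis .
  qed
  show ?thesis using mat_tendsto_eventually_norm_bound[OF X_tendsto e]
  proof eventually_elim
    case (elim k)
    note Xk = X_carrier[of k] and R = resolvent(1)[OF X_substochastic[of k]]
    have T: "two_minus n (X k) \<in> carrier_mat n n" using Xk by (rule minus_carrier_mat)
    have E: "X k - G \<in> carrier_mat n n" by (rule minus_carrier_mat[OF G_carrier])
    have "two_minus n (X k) * (resolvent n (X k) - H) = two_minus n G * H - two_minus n (X k) * H"
      using mult_minus_distrib_mat[OF T R H_carrier] resolvent(2)[OF X_substochastic[of k]]
        resolvent(2)[OF G_substochastic] by simp
    also have "\<dots> = (X k - G) * H"
    proof -
      define A B where "A = G * H" and "B = X k * H"
      have "A \<in> carrier_mat n n" "B \<in> carrier_mat n n"
        unfolding A_def B_def by (rule mult_carrier_mat[OF _ H_carrier], simp add: Xk)+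
      then have "(2 \<cdot>\<^sub>m H - A) - (2 \<cdot>\<^sub>m H - B) = B - A"
        using H_carrier by (intro eq_matI) auto
      then show ?thesis
        using two_minus_mult[OF G_carrier H_carrier] two_minus_mult[OF Xk H_carrier]
          minus_mult_distrib_mat[OF Xk G_carrier H_carrier] by (simp add: A_def B_def)
    qed
    finally have "resolvent n (X k) - H = resolvent n (X k) * ((X k - G) * H)"
      using resolvent_two_minus_mult[OF X_substochastic[of k] minus_carrier_mat[OF H_carrier]] by metis
    moreover have "norm_bound (resolvent n (X k) * ((X k - G) * H)) (K * (e * K * n) * n)"
      using K(2) X_substochastic G_substochastic substochastic_resolvent elim
      by (intro norm_bound_mult[OF R mult_carrier_mat[OF E H_carrier]] norm_bound_mult[OF E H_carrier]) auto
    ultimately show ?case using norm_bound_mono le by metis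
  qed
qed

text \<open>Common core of both rates: \<open>F k\<close> is bounded by every rate above
  \<open>\<tau>\<close>, the powers of the deflated \<open>G\<close> by every rate above
  \<open>cmod (l 2)\<close>. It is used with \<open>\<tau> = 1\<close> and with the largest
  \<open>1 / cmod (2 - l j)\<close>.\<close>

lemma limsup_error_le:
  assumes X0u: "X 0 *\<^sub>v u = u" and l: "ordered_eigenvalues n G l" and \<nu>: "matrix_norm n \<nu>" and "0 \<le> \<tau>"
    and F_bound: "\<And>\<rho>. \<tau> < \<rho> \<Longrightarrow> \<exists>C. \<forall>\<^sub>F k in sequentially. norm_bound (F k) (C * \<rho> ^ k)"
  shows "limsup (\<lambda>k. ereal (\<nu> (X k - G) powr (1 / real k))) \<le> ereal (\<tau> * cmod (l 2))"
proof (rule limsup_root_le)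
  have E: "X k - G \<in> carrier_mat n n" for k by (rule minus_carrier_mat[OF G_carrier])
  then show "0 \<le> \<nu> (X k - G)" for k using \<nu> by (simp add: matrix_norm_def)
  show "0 \<le> \<tau> * cmod (l 2)" using \<open>0 \<le> \<tau>\<close> by simp
  fix r assume "\<tau> * cmod (l 2) < r"
  then obtain \<rho> s where \<rho>: "\<tau> < \<rho>" and s: "cmod (l 2) < s" and \<rho>s: "\<rho> * s < r"
    using nearby_product_less[OF \<open>0 \<le> \<tau>\<close> norm_ge_zero] by metis
  \<comment> \<open>A multiple of the first coordinate functional, normalised so that deflation
    moves the eigenvalue 1 to 0.\<close>
  define w where "w = (1 / u $ 0) \<cdot>\<^sub>v unit_vec n 0"
  have w: "w \<in> carrier_vec n" "w \<bullet> u = 1"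
    using u_pos[OF n_pos] n_pos by (auto simp: w_def)
  let ?Q = "deflate n G u w"
  have s0: "0 < s" using s norm_ge_zero le_less_trans by blast
  obtain C2 where C2: "\<And>k. norm_bound (?Q ^\<^sub>m k) (C2 * s ^ k)"
    using pow_mat_bound[OF deflate_carrier n_pos deflate_G_eigenvalue[OF l w] s s0] by blast
  obtain C1 where C1: "\<forall>\<^sub>F k in sequentially. norm_bound (F k) (C1 * \<rho> ^ k)" using F_bound[OF \<rho>] by blast
  obtain K where K: "0 \<le> K" "\<And>A b. A \<in> carrier_mat n n \<Longrightarrow> norm_bound A b \<Longrightarrow> \<nu> A \<le> K * b"
    using matrix_norm_le_entries[OF \<nu>] by blast
  have "\<forall>\<^sub>F k in sequentially. \<nu> (X k - G) \<le> \<bar>K * C1 * C2 * n\<bar> * r ^ k"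
    using C1
  proof eventually_elim
    case (elim k)
    have "norm_bound (X k - G) (C1 * \<rho> ^ k * (C2 * s ^ k) * n)"
      unfolding error_eq_deflate[OF X0u, of k w]
      by (rule norm_bound_mult[OF F_carrier pow_carrier_mat[OF deflate_carrier] elim C2])
    from K(2)[OF E this] have "\<nu> (X k - G) \<le> K * C1 * C2 * n * (\<rho> * s) ^ k"
      by (simp add: power_mult_distrib mult_ac)
    also have "\<dots> \<le> \<bar>K * C1 * C2 * n\<bar> * (\<rho> * s) ^ k"
      using \<rho> \<open>0 \<le> \<tau>\<close> s0 by (intro mult_right_mono) auto
    also have "\<dots> \<le> \<bar>K * C1 * C2 * n\<bar> * r ^ k"
      using \<rho> \<rho>s \<open>0 \<le> \<tau>\<close> s0 by (intro mult_left_mono power_mono) auto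
    finally show ?case .
  qed
  then show "\<exists>C. \<forall>\<^sub>F k in sequentially. \<nu> (X k - G) \<le> C * r ^ k" by blast
qed

lemma F_bounded: "\<exists>C. \<forall>k. norm_bound (F k) C"
proof -
  obtain K where K: "\<And>X. substochastic n u X \<Longrightarrow> norm_bound X K"
    using substochastic_norm_bound by blast
  obtain b where b: "norm_bound (X 0 - G) b" using norm_bound_exists .
  have "norm_bound (F k) (K * b * n)" for k
    unfolding F_def
    by (rule norm_bound_mult[OF substochasticD(1)[OF left_factor_substochastic] minus_carrier_mat[OF G_carrier]
        K[OF left_factor_substochastic] b])
  then show ?thesis by blast
qed

lemma limsup_error_le_second_eigenvalue:
  assumes "X 0 *\<^sub>v u = u" "ordered_eigenvalues n G l" "matrix_norm n \<nu>"
  shows "limsup (\<lambda>k. ereal (\<nu> (X k - G) powr (1 / real k))) \<le> ereal (cmod (l 2))"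
proof -
  have "\<exists>C. \<forall>\<^sub>F k in sequentially. norm_bound (F k) (C * \<rho> ^ k)" if "1 < \<rho>" for \<rho> :: real
  proof -
    obtain C where C: "\<And>k. norm_bound (F k) C" using F_bounded by blast
    have "norm_bound (F k) (\<bar>C\<bar> * \<rho> ^ k)" for k
    proof (rule norm_bound_mono[OF C])
      have "\<bar>C\<bar> * 1 \<le> \<bar>C\<bar> * \<rho> ^ k" using that by (intro mult_left_mono one_le_power) auto
      then show "C \<le> \<bar>C\<bar> * \<rho> ^ k" by simp
    qed
    then show ?thesis by (intro exI[of _ "\<bar>C\<bar>"]) simp
  qed
  from limsup_error_le[OF assms, of 1, OF _ this] show ?thesis by simp
qed

lemma left_fixed_X:
  assumes v: "v \<in> carrier_vec n" and vN: "mat_of_row v * N = mat_of_row v"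
    and vX: "mat_of_row v * X 0 = mat_of_row v"
  shows "mat_of_row v * X k = mat_of_row v"
proof (induction k)
  case (Suc k)
  have V: "mat_of_row v \<in> carrier_mat 1 n" using v by simp
  show ?case unfolding X_Suc
    using assoc_mult_mat[OF V resolvent(1)[OF X_substochastic[of k]] N_carrier]
      left_fixed_resolvent[OF X_substochastic v Suc] vN by simp
qed (rule vX)

text \<open>The row equation holds for every iterate and passes to their limit.\<close>

lemma left_fixed_G:
  assumes v: "v \<in> carrier_vec n" and vX: "\<And>k. mat_of_row v * X k = mat_of_row v"
  shows "mat_of_row v * G = mat_of_row v"
proof (rule eq_matI)
  have V: "mat_of_row v \<in> carrier_mat 1 n" using v by simp
  fix i j assume "i < dim_row (mat_of_row v)" "j < dim_col (mat_of_row v)"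
  then have ij: "i < 1" "j < n" using v by auto
  have "(\<lambda>k. (mat_of_row v * X k) $$ (i, j)) \<longlonglongrightarrow> (mat_of_row v * G) $$ (i, j)"
    unfolding index_mult_mat_sum[OF V X_carrier ij] index_mult_mat_sum[OF V G_carrier ij]
    using X_tendsto ij by (intro tendsto_intros) (auto simp: mat_tendsto_def)
  then show "(mat_of_row v * G) $$ (i, j) = mat_of_row v $$ (i, j)"
    unfolding vX by (simp add: LIMSEQ_const_iff)
qed (use v in auto)

lemma left_zero_F:
  assumes v: "v \<in> carrier_vec n" and vX: "\<And>k. mat_of_row v * X k = mat_of_row v"
  shows "mat_of_row v * F k = 0\<^sub>m 1 n"
proof (induction k)
  have V: "mat_of_row v \<in> carrier_mat 1 n" using v by simp
  {
    case 0
    show ?case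
      unfolding F_0 mult_minus_distrib_mat[OF V X_carrier G_carrier] vX left_fixed_G[OF assms]
      by (rule minus_r_inv_mat[OF V])
  next
    case (Suc k)
    show ?case unfolding F_Suc
      using assoc_mult_mat[OF V resolvent(1)[OF X_substochastic[of k]] F_carrier]
        left_fixed_resolvent[OF X_substochastic v vX] Suc by simp
  }
qed

text \<open>Since \<open>v^T F k = 0\<close>, the resolvent acting on \<open>F k\<close> may be
  written as the deflation of \<open>H\<close> plus the vanishing perturbation \<open>D k\<close>.
  The eigenvalues of the deflated \<open>H\<close> are at most \<open>\<tau>\<close> in modulus, and
  a small perturbation costs only the gap to \<open>\<rho>\<close>.\<close>

lemma F_bound_left_fixed:
  assumes v: "v \<in> carrier_vec n" "positive_vec v" and vX: "\<And>k. mat_of_row v * X k = mat_of_row v"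
    and l: "ordered_eigenvalues n G l" and "0 < \<tau>"
    and \<tau>: "\<And>j. j \<in> {2..n} \<Longrightarrow> 1 / cmod (2 - l j) \<le> \<tau>" and "\<tau> < \<rho>"
  shows "\<exists>C. \<forall>\<^sub>F k in sequentially. norm_bound (F k) (C * \<rho> ^ k)"
proof -
  have vu: "0 < v \<bullet> u" unfolding scalar_prod_def
    using v u_pos n_pos by (intro sum_pos) (auto simp: positive_vec_def)
  \<comment> \<open>Rescaled so that \<open>w \<bullet> u = 1\<close>; as a multiple of
    \<open>v\<close> it annihilates the columns of \<open>F k\<close>.\<close>
  define w where "w = (1 / (v \<bullet> u)) \<cdot>\<^sub>v v"
  have w: "w \<in> carrier_vec n" "w \<bullet> u = 1"
    using v vu by (auto simp: w_def)
  let ?P = "deflate n H u w"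
  \<comment> \<open>The midpoint leaves room below for bounding the powers of \<open>?P\<close> and
    above for the perturbation.\<close>
  define t where "t = (\<tau> + \<rho>) / 2"
  have t: "\<tau> < t" "t < \<rho>" "0 < t" using \<open>0 < \<tau>\<close> \<open>\<tau> < \<rho>\<close> by (auto simp: t_def)
  have "cmod \<mu> \<le> \<tau>" if "eigenvalue (complex_mat ?P) \<mu>" for \<mu>
    using deflate_H_eigenvalue[OF l w that] \<tau> \<open>0 < \<tau>\<close> by (cases "\<mu> = 0") auto
  from pow_mat_bound[OF deflate_carrier n_pos this t(1,3)]
  obtain C where C: "0 \<le> C" "\<And>k. norm_bound (?P ^\<^sub>m k) (C * t ^ k)" by blast
  \<comment> \<open>Chosen so that the perturbed rate \<open>t + C * \<delta> * n * n\<close> does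
    not exceed \<open>\<rho>\<close>.\<close>
  define \<delta> where "\<delta> = (\<rho> - t) / (C * n * n + 1)"
  have pos: "0 < C * n * n + 1" using C(1) by (simp add: add_nonneg_pos)
  have \<delta>: "0 < \<delta>" using t pos by (simp add: \<delta>_def)
  have C\<delta>: "t + C * \<delta> * n * n \<le> \<rho>"
  proof -
    have "C * \<delta> * n * n \<le> \<delta> * (C * n * n + 1)" using \<delta> by (simp add: algebra_simps)
    also have "\<dots> = \<rho> - t" using pos by (simp add: \<delta>_def)
    finally show ?thesis by simp
  qed
  define D where "D k = resolvent n (X k) - H" for k
  have D: "D k \<in> carrier_mat n n" for k unfolding D_def by (rule minus_carrier_mat[OF H_carrier])
  obtain k0 where k0: "\<And>k. k0 \<le> k \<Longrightarrow> norm_bound (D k) \<delta>"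
    using resolvent_tendsto[OF \<delta>] unfolding eventually_sequentially D_def by blast
  have step: "F (Suc k) = (?P + D k) * F k" for k
  proof -
    note R = resolvent(1)[OF X_substochastic[of k]]
    have "w \<bullet> col (F k) j = 0" if "j < n" for j
    proof -
      have "v \<bullet> col (F k) j = (mat_of_row v * F k) $$ (0, j)"
        using that carrier_matD[OF F_carrier[of k]] by simp
      also have "\<dots> = 0" using that by (simp only: left_zero_F[OF v(1) vX]) simp
      finally show ?thesis
        using v(1) that carrier_matD[OF F_carrier[of k]] by (simp add: w_def)
    qed
    then have "?P * F k = H * F k"
      by (intro deflate_mult[OF F_carrier H_carrier u_carrier w(1)])
    then have "(?P + D k) * F k = H * F k + D k * F k"
      using add_mult_distrib_mat[OF deflate_carrier D F_carrier] by simp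
    also have "\<dots> = (H + D k) * F k"
      using add_mult_distrib_mat[OF H_carrier D F_carrier] by simp
    also have "H + D k = resolvent n (X k)"
      unfolding D_def using R H_carrier by (intro eq_matI) auto
    finally show ?thesis by (simp add: F_Suc)
  qed
  obtain f where f: "0 \<le> f" "norm_bound (F k0) f" using norm_bound_exists .
  have bound: "norm_bound (F (k0 + k)) (n * C * f * \<rho> ^ k)" for k
  proof -
    \<comment> \<open>The case \<open>m = 0\<close>, on sequences shifted by \<open>k0\<close>,
      beyond which the perturbation is at most \<open>\<delta>\<close>.\<close>
    have "norm_bound (?P ^\<^sub>m 0 * F (k0 + k)) (n * C * f * t ^ 0 * (t + C * \<delta> * n * n) ^ k)"
      by (rule perturbed_product_bound[where F = "\<lambda>k. F (k0 + k)" and D = "\<lambda>k. D (k0 + k)"])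
        (use D C k0 f step in auto)
    then have "norm_bound (F (k0 + k)) (n * C * f * (t + C * \<delta> * n * n) ^ k)"
      using F_carrier[of "k0 + k"] by (simp add: deflate_def)
    moreover have "n * C * f * (t + C * \<delta> * n * n) ^ k \<le> n * C * f * \<rho> ^ k"
      using C(1) f(1) \<delta> t C\<delta> by (intro mult_left_mono power_mono) auto
    ultimately show ?thesis by (rule norm_bound_mono)
  qed
  have "norm_bound (F k) (n * C * f / \<rho> ^ k0 * \<rho> ^ k)" if "k0 \<le> k" for k
    using bound[of "k - k0"] that t by (simp add: power_diff)
  then show ?thesis unfolding eventually_sequentially by blast
qed

text \<open>The factor \<open>cmod (l 2)\<close> is common to all terms of the maximum, so it may be
  taken out of it.\<close>

lemma limsup_error_le_left_fixed:
  assumes "2 \<le> n" and X0u: "X 0 *\<^sub>v u = u" and l: "ordered_eigenvalues n G l" and \<nu>: "matrix_norm n \<nu>"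
    and v: "v \<in> carrier_vec n" "positive_vec v" and vN: "mat_of_row v * N = mat_of_row v"
    and vX: "mat_of_row v * X 0 = mat_of_row v"
  shows "limsup (\<lambda>k. ereal (\<nu> (X k - G) powr (1 / real k)))
    \<le> ereal (MAX j\<in>{2..n}. cmod (l 2 / (2 - l j)))"
proof -
  define \<tau> where "\<tau> = (MAX j\<in>{2..n}. 1 / cmod (2 - l j))"
  have "\<tau> \<in> (\<lambda>j. 1 / cmod (2 - l j)) ` {2..n}"
    unfolding \<tau>_def using \<open>2 \<le> n\<close> by (intro Max_in) auto
  then obtain j where j: "j \<in> {2..n}" "\<tau> = 1 / cmod (2 - l j)" by auto
  \<comment> \<open>This excludes \<open>2 - l j = 0\<close>, for which division by zero would make
    \<open>\<tau>\<close> vanish.\<close>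
  have "cmod (l j) < 1"
    using ordered_eigenvalues_le[OF l] j l by (force simp: ordered_eigenvalues_def)
  then have "2 - l j \<noteq> 0" by auto
  then have \<tau>: "0 < \<tau>" using j(2) by simp
  have "limsup (\<lambda>k. ereal (\<nu> (X k - G) powr (1 / real k))) \<le> ereal (\<tau> * cmod (l 2))"
  proof (rule limsup_error_le[OF X0u l \<nu>])
    show "\<exists>C. \<forall>\<^sub>F k in sequentially. norm_bound (F k) (C * \<rho> ^ k)" if "\<tau> < \<rho>" for \<rho>
      by (rule F_bound_left_fixed[OF v left_fixed_X[OF v(1) vN vX] l \<tau> _ that]) (simp add: \<tau>_def)
  qed (use \<tau> in simp)
  also have "\<tau> * cmod (l 2) = cmod (l 2 / (2 - l j))" by (simp add: j(2) norm_divide)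
  also have "\<dots> \<le> (MAX j\<in>{2..n}. cmod (l 2 / (2 - l j)))" using j(1) by (intro Max_ge) auto
  finally show ?thesis by simp
qed

end

theorem theorem3:
  fixes n :: nat and A N X0 :: "real mat" and u :: "real vec" and X :: "nat \<Rightarrow> real mat"
  assumes "n \<ge> 2"
    and "N \<in> carrier_mat n n" and "0\<^sub>m n n \<le> N"
    and "A = 1\<^sub>m n - N"
    and "M_matrix n A" and "\<not> invertible_mat A"
    and "u \<in> carrier_vec n" and "positive_vec u" and "N *\<^sub>v u = u"
    and "simple_eigenvalue N 1"
    and "X0 \<in> carrier_mat n n" and "0\<^sub>m n n \<le> X0" and "X0 *\<^sub>v u \<le> u"
    and "X 0 = X0"
    and "\<And>k. X (Suc k) = the (mat_inverse (2 \<cdot>\<^sub>m 1\<^sub>m n - X k)) * N"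
  shows "(\<forall>k. X k \<in> carrier_mat n n \<and> 0\<^sub>m n n \<le> X k \<and> X k *\<^sub>v u \<le> u \<and>
           M_matrix n (2 \<cdot>\<^sub>m 1\<^sub>m n - X k) \<and> invertible_mat (2 \<cdot>\<^sub>m 1\<^sub>m n - X k)) \<and>
    (\<exists>G. minimal_nonneg_solution n N G \<and> mat_tendsto n X G \<and>
      (\<exists>l. ordered_eigenvalues n G l) \<and>
      (X0 *\<^sub>v u = u \<longrightarrow> (\<forall>k. X k *\<^sub>v u = u)) \<and>
      (\<forall>l \<nu>. ordered_eigenvalues n G l \<and> matrix_norm n \<nu> \<and> X0 *\<^sub>v u = u \<longrightarrow>
        limsup (\<lambda>k. ereal (\<nu> (X k - G) powr (1 / real k))) \<le> ereal (cmod (l 2)) \<and>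
        (\<forall>v. v \<in> carrier_vec n \<and> positive_vec v \<and>
             mat_of_row v * N = mat_of_row v \<and> mat_of_row v * X0 = mat_of_row v \<longrightarrow>
          limsup (\<lambda>k. ereal (\<nu> (X k - G) powr (1 / real k)))
            \<le> ereal (MAX j\<in>{2..n}. cmod (l 2 / (2 - l j))))))"
proof -
  interpret iteration n u N X
    using assms by unfold_locales (auto simp: substochastic_def)
  have "X k \<in> carrier_mat n n \<and> 0\<^sub>m n n \<le> X k \<and> X k *\<^sub>v u \<le> u \<and>
      M_matrix n (two_minus n (X k)) \<and> invertible_mat (two_minus n (X k))" for k
    using X_substochastic[of k] M_matrix_two_minus resolvent(5) by (auto simp: substochastic_def)
  moreover have "X k *\<^sub>v u = u" if "X0 *\<^sub>v u = u" for k
    using X_u that \<open>X 0 = X0\<close> by simp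
  moreover have "limsup (\<lambda>k. ereal (\<nu> (X k - G) powr (1 / real k))) \<le> ereal (cmod (l 2))"
    if "ordered_eigenvalues n G l" "matrix_norm n \<nu>" "X0 *\<^sub>v u = u" for l \<nu>
    using limsup_error_le_second_eigenvalue that \<open>X 0 = X0\<close> by simp
  moreover have "limsup (\<lambda>k. ereal (\<nu> (X k - G) powr (1 / real k)))
      \<le> ereal (MAX j\<in>{2..n}. cmod (l 2 / (2 - l j)))"
    if "ordered_eigenvalues n G l" "matrix_norm n \<nu>" "X0 *\<^sub>v u = u"
      "v \<in> carrier_vec n" "positive_vec v" "mat_of_row v * N = mat_of_row v"
      "mat_of_row v * X0 = mat_of_row v" for l \<nu> v
    using limsup_error_le_left_fixed[OF \<open>n \<ge> 2\<close>] that \<open>X 0 = X0\<close> by simp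
  ultimately show ?thesis
    using G_minimal X_tendsto ordered_eigenvalues_G[OF \<open>n \<ge> 2\<close>] by blast
qed

end
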